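(* Let $\delta\in(0,1]$ be a constant and let $\lambda=\lambda_n>0$ (possibly depending on $n$). Suppose $G\sim\mathcal{G}(n,\lambda,\delta)$ is generated from the planted cycles model and $H^*$ is the hidden $2$-factor on the set of $\delta n$ vertices. If $\lambda=o(1)$, then with probability $1-o(1)$, $H^*$ is the only $2$-factor on $\delta n$ vertices contained in $G$. Conversely, if $\lambda=\Omega(1)$, then with probability $\Omega(1)$, $G$ contains another $2$-factor on $\delta n$ vertices which is different from $H^*$.
   Context: Planted cycles model $\mathcal{G}(n,\lambda,\delta)$: generate an Erdős–Rényi graph $G_0\sim\mathcal{G}(n,\lambda/n)$ on vertex set $[n]$ (with $\lambda/n\le 1$); independently choose a uniformly random set $V\subseteq[n]$ of $\lfloor\delta n\rfloor$ vertices (written $\delta n$); then choose a uniformly random labeled $2$-factor $H^*$ on $V$, i.e. a vertex-disjoint union of cycles spanning all vertices of $V$. Output the simple graph $G=G_0\cup H^*$. A $2$-factor on $\delta n$ vertices contained in $G$ is a subgraph of $G$ that is a vertex-disjoint union of cycles with exactly $\lfloor\delta n\rfloor$ vertices in total (its vertex set may differ from $V$). Asymptotic notation is as $n\to\infty$. *)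

theory Defs
  imports "HOL-Probability.Probability" "HOL-Library.Landau_Symbols" "HOL-Library.Disjoint_Sets"
begin

text \<open>
  A simple graph is represented by its set of edges, an edge being a two-element set of vertices.
  A graph in which every vertex has positive degree, such as a cycle or a 2-factor, is determined
  by its edge set \<open>H\<close>, and its vertex set is \<open>\<Union>H\<close>.
\<close>

type_synonym edges = "nat set set"

definition complete_edges :: "nat set \<Rightarrow> edges" where
  "complete_edges V = {e. e \<subseteq> V \<and> card e = 2}"

definition is_cycle :: "edges \<Rightarrow> bool" where
  "is_cycle C \<longleftrightarrow> (\<exists>xs. distinct xs \<and> 3 \<le> length xs \<and>
     C = {{xs ! i, xs ! (Suc i mod length xs)} | i. i < length xs})"

definition two_factor_on :: "nat set \<Rightarrow> edges \<Rightarrow> bool" where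
  "two_factor_on V H \<longleftrightarrow>
     (\<exists>\<C>. (\<forall>C\<in>\<C>. is_cycle C) \<and> disjoint_family_on Union \<C> \<and> H = \<Union>\<C> \<and> \<Union>H = V)"

definition two_factors_in :: "edges \<Rightarrow> nat \<Rightarrow> edges set" where
  "two_factors_in G k = {H. H \<subseteq> G \<and> card (\<Union>H) = k \<and> two_factor_on (\<Union>H) H}"

definition erdos_renyi :: "nat \<Rightarrow> real \<Rightarrow> edges pmf" where
  "erdos_renyi n p =
     map_pmf (\<lambda>f. {e \<in> complete_edges {1..n}. f e})
       (Pi_pmf (complete_edges {1..n}) False (\<lambda>_. bernoulli_pmf p))"

definition planted_size :: "nat \<Rightarrow> real \<Rightarrow> nat" where
  "planted_size n \<delta> = nat \<lfloor>\<delta> * real n\<rfloor>"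

text \<open>
  The joint distribution of the observed graph and the hidden 2-factor. The model is only
  meaningful if \<open>l / n \<le> 1\<close> and if a 2-factor on \<open>planted_size n \<delta>\<close> vertices exists, i.e.
  unless this size is 1 or 2; for fixed \<open>\<delta> > 0\<close> the latter excludes only finitely many \<open>n\<close>.
\<close>

definition planted_cycles :: "nat \<Rightarrow> real \<Rightarrow> real \<Rightarrow> (edges \<times> edges) pmf" where
  "planted_cycles n l \<delta> = do {
     G\<^sub>0 \<leftarrow> erdos_renyi n (l / real n);
     V \<leftarrow> pmf_of_set {V. V \<subseteq> {1..n} \<and> card V = planted_size n \<delta>};
     H \<leftarrow> pmf_of_set {H. two_factor_on V H};
     return_pmf (G\<^sub>0 \<union> H, H)
   }"

end

theory Submission
  imports Defs
begin

text \<open>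
  2-factors on \<open>V\<close> are exactly the graphs on \<open>V\<close> in which every vertex has degree 2, because a graph
  with even degrees is an edge-disjoint union of cycles.

  Small \<open>\<lambda>\<close>: given \<open>H\<close>, another 2-factor \<open>H'\<close> lies in \<open>G\<close> with probability \<open>p ^ r\<close>, where
  \<open>p = \<lambda> / n\<close> and \<open>r = |H' - H| = |H - H'|\<close>. With \<open>y = sqrt \<lambda>\<close> and \<open>q = sqrt \<lambda> / n\<close> this is
  \<open>y ^ |H - H'| q ^ |H' - H|\<close>, which is multiplicative over the cycles into which the symmetric
  difference of \<open>H\<close> and \<open>H'\<close> decomposes. Hence the expected number of such \<open>H'\<close> is at most
  \<open>exp W - 1\<close>, where \<open>W\<close> is the total weight of all cycles of the complete graph. Cycles not
  contained in \<open>H\<close> contribute \<open>O(sqrt \<lambda>)\<close>, since each step of a closed walk either follows one of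
  at most two edges of \<open>H\<close>, at cost \<open>y\<close>, or goes to one of \<open>n\<close> vertices, at cost \<open>q\<close>. For the
  cycles of \<open>H\<close> itself the randomness of \<open>H\<close> is needed: their number of length \<open>j\<close> has mean at
  most \<open>1 + j\<close>, as one sees by deleting the cycle and reinserting its vertices by subdividing edges.

  Large \<open>\<lambda>\<close>: \<open>H\<close> contains an induced matching with linearly many edges \<open>{a, b}\<close>. Replacing two of
  them, \<open>{a, b}\<close> and \<open>{c, d}\<close>, by \<open>{a, c}\<close> and \<open>{b, d}\<close> preserves all degrees. Pairing the
  edges of one half of the matching with those of the other half gives order \<open>n\<^sup>2\<close> such switches,
  which are available independently, each with probability \<open>p\<^sup>2\<close>.
\<close>

section \<open>Paths, cycles and vertex degrees\<close>

fun path_edges :: "'a list \<Rightarrow> 'a set set" where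
  "path_edges [] = {}"
| "path_edges [x] = {}"
| "path_edges (x # y # zs) = insert {x, y} (path_edges (y # zs))"

text \<open>The index-free form of the edge set in \<open>is_cycle\<close>. Splitting off the
  closing edge allows induction along the list and lets any chosen edge be made the closing
  one.\<close>

definition cycle_edges :: "'a list \<Rightarrow> 'a set set" where
  "cycle_edges xs = insert {last xs, hd xs} (path_edges xs)"

lemma path_edges_Cons: "xs \<noteq> [] \<Longrightarrow> path_edges (x # xs) = insert {x, hd xs} (path_edges xs)"
  by (cases xs) auto

lemma path_edges_append:
  "xs \<noteq> [] \<Longrightarrow> ys \<noteq> [] \<Longrightarrow>
     path_edges (xs @ ys) = insert {last xs, hd ys} (path_edges xs \<union> path_edges ys)"
  by (induction xs rule: path_edges.induct) (auto simp: path_edges_Cons)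

lemma path_edges_conv_nth:
  "path_edges xs = {{xs ! i, xs ! Suc i} | i. Suc i < length xs}"
proof (induction xs rule: path_edges.induct)
  case (3 x y zs)
  have "{{(x # y # zs) ! i, (x # y # zs) ! Suc i} | i. Suc i < length (x # y # zs)}
      = insert {x, y} {{(y # zs) ! i, (y # zs) ! Suc i} | i. Suc i < length (y # zs)}" (is "?L = ?R")
  proof (intro equalityI subsetI)
    fix e assume "e \<in> ?L"
    then obtain i where "e = {(x # y # zs) ! i, (x # y # zs) ! Suc i}" "Suc i < length (x # y # zs)"
      by blast
    thus "e \<in> ?R" by (cases i) auto
  next
    fix e assume "e \<in> ?R"
    thus "e \<in> ?L"
    proof
      assume "e = {x, y}" thus ?thesis by (intro CollectI exI[of _ 0]) auto
    next
      assume "e \<in> {{(y # zs) ! i, (y # zs) ! Suc i} | i. Suc i < length (y # zs)}"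
      then obtain i where "e = {(y # zs) ! i, (y # zs) ! Suc i}" "Suc i < length (y # zs)" by blast
      thus ?thesis by (intro CollectI exI[of _ "Suc i"]) auto
    qed
  qed
  with 3 show ?case by simp
qed auto

lemma cycle_edges_conv_nth:
  assumes "xs \<noteq> []"
  shows "{{xs ! i, xs ! (Suc i mod length xs)} | i. i < length xs} = cycle_edges xs" (is "?L = _")
proof -
  let ?f = "\<lambda>i. {xs ! i, xs ! (Suc i mod length xs)}"
  have "{i. i < length xs} = insert (length xs - 1) {i. Suc i < length xs}"
    using assms by (cases xs) auto
  hence "?f ` {i. i < length xs} = insert (?f (length xs - 1)) (?f ` {i. Suc i < length xs})"
    by (simp only: image_insert)
  hence "?L = insert {xs ! (length xs - 1), xs ! (Suc (length xs - 1) mod length xs)}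
               {{xs ! i, xs ! (Suc i mod length xs)} | i. Suc i < length xs}"
    by (simp only: setcompr_eq_image)
  also have "{{xs ! i, xs ! (Suc i mod length xs)} | i. Suc i < length xs} = path_edges xs"
    unfolding path_edges_conv_nth by (metis mod_less)
  finally show ?thesis
    using assms by (simp add: cycle_edges_def last_conv_nth hd_conv_nth)
qed

lemma is_cycle_iff: "is_cycle C \<longleftrightarrow> (\<exists>xs. distinct xs \<and> 3 \<le> length xs \<and> C = cycle_edges xs)"
proof -
  have "{{xs ! i, xs ! (Suc i mod length xs)} | i. i < length xs} = cycle_edges xs"
    if "3 \<le> length xs" for xs :: "nat list"
    using that by (intro cycle_edges_conv_nth) auto
  thus ?thesis unfolding is_cycle_def by (metis (no_types, lifting))
qed

lemma cycle_edges_rotate: "cycle_edges (xs @ ys) = cycle_edges (ys @ xs)"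
  by (cases "xs = []"; cases "ys = []") (auto simp: cycle_edges_def path_edges_append)

lemma split_path_edge:
  "e \<in> path_edges xs \<Longrightarrow> \<exists>us vs. xs = us @ vs \<and> us \<noteq> [] \<and> vs \<noteq> [] \<and> e = {last us, hd vs}"
proof (induction xs rule: path_edges.induct)
  case (3 x y zs)
  show ?case
  proof (cases "e = {x, y}")
    case True
    thus ?thesis by (intro exI[of _ "[x]"] exI[of _ "y # zs"]) auto
  next
    case False
    with 3 obtain us vs where "y # zs = us @ vs" "us \<noteq> []" "vs \<noteq> []" "e = {last us, hd vs}"
      by auto
    thus ?thesis by (intro exI[of _ "x # us"] exI[of _ vs]) auto
  qed
qed auto

text \<open>Swapping the two parts of the list at a path edge turns that edge into the closing edge.
  Equality of multisets is recorded because it transfers distinctness and length to the new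
  list.\<close>

lemma rotate_edge_to_end:
  assumes "e \<in> cycle_edges xs"
  shows "\<exists>ys. cycle_edges ys = cycle_edges xs \<and> mset ys = mset xs \<and> e = {last ys, hd ys}"
proof (cases "e = {last xs, hd xs}")
  case False
  with assms obtain us vs where "xs = us @ vs" "us \<noteq> []" "vs \<noteq> []" "e = {last us, hd vs}"
    using split_path_edge by (metis cycle_edges_def insertE)
  thus ?thesis by (intro exI[of _ "vs @ us"]) (auto simp: cycle_edges_rotate[of vs us] union_commute)
qed auto

lemma finite_path_edges [simp]: "finite (path_edges xs)"
  by (induction xs rule: path_edges.induct) auto

lemma Union_path_edges_subset: "\<Union>(path_edges xs) \<subseteq> set xs"
  by (induction xs rule: path_edges.induct) auto

lemma finite_cycle_edges [simp]: "finite (cycle_edges xs)"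
  by (simp add: cycle_edges_def)

lemma Union_cycle_edges: "xs \<noteq> [] \<Longrightarrow> \<Union>(cycle_edges xs) = set xs"
proof
  assume "xs \<noteq> []"
  thus "\<Union>(cycle_edges xs) \<subseteq> set xs"
    using Union_path_edges_subset[of xs] by (auto simp: cycle_edges_def)
  have "set xs \<subseteq> insert (hd xs) (\<Union>(path_edges xs))"
    by (induction xs rule: path_edges.induct) auto
  thus "set xs \<subseteq> \<Union>(cycle_edges xs)" by (auto simp: cycle_edges_def)
qed

lemma path_edges_card: "distinct xs \<Longrightarrow> e \<in> path_edges xs \<Longrightarrow> card e = 2"
  by (induction xs rule: path_edges.induct) auto

section \<open>Vertex degrees\<close>

definition vdegree :: "'a set set \<Rightarrow> 'a \<Rightarrow> nat" where
  "vdegree H v = card {e \<in> H. v \<in> e}"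

lemma vdegree_diff: "finite H \<Longrightarrow> R \<subseteq> H \<Longrightarrow> vdegree (H - R) v = vdegree H v - vdegree R v"
proof -
  assume a: "finite H" "R \<subseteq> H"
  have "{e \<in> H - R. v \<in> e} = {e \<in> H. v \<in> e} - {e \<in> R. v \<in> e}" by auto
  thus ?thesis unfolding vdegree_def using a
    by (simp add: card_Diff_subset finite_subset[OF a(2) a(1)] Collect_mono_iff subset_eq)
qed

lemma vdegree_mono: "finite H \<Longrightarrow> R \<subseteq> H \<Longrightarrow> vdegree R v \<le> vdegree H v"
  unfolding vdegree_def by (intro card_mono) auto

lemma vdegree_Un: "finite H \<Longrightarrow> finite R \<Longrightarrow> H \<inter> R = {} \<Longrightarrow> vdegree (H \<union> R) v = vdegree H v + vdegree R v"
proof -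
  assume a: "finite H" "finite R" "H \<inter> R = {}"
  have "{e \<in> H \<union> R. v \<in> e} = {e \<in> H. v \<in> e} \<union> {e \<in> R. v \<in> e}" by auto
  thus ?thesis unfolding vdegree_def using a by (simp add: card_Un_disjoint disjoint_iff)
qed

lemma vdegree_empty [simp]: "vdegree {} v = 0"
  by (simp add: vdegree_def)

lemma vdegree_insert:
  "finite H \<Longrightarrow> e \<notin> H \<Longrightarrow> vdegree (insert e H) v = vdegree H v + (if v \<in> e then 1 else 0)"
proof -
  assume a: "finite H" "e \<notin> H"
  have "{e' \<in> insert e H. v \<in> e'} = (if v \<in> e then {e} else {}) \<union> {e \<in> H. v \<in> e}" by auto
  thus ?thesis unfolding vdegree_def using a by simp
qed

lemma vdegree_eq_0_iff: "finite H \<Longrightarrow> vdegree H v = 0 \<longleftrightarrow> v \<notin> \<Union>H"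
  by (auto simp: vdegree_def)

text \<open>After \<open>v\<close> is rotated to the front, its two edges lead to the first and to
  the last of the remaining vertices. These differ because at least two vertices remain.\<close>

lemma cycle_vdegree:
  assumes "distinct xs" "3 \<le> length xs" "v \<in> set xs"
  shows "vdegree (cycle_edges xs) v = 2"
proof -
  obtain us vs where xs: "xs = us @ v # vs" using assms(3) by (meson split_list)
  define ys where "ys = vs @ us"
  have C: "cycle_edges xs = cycle_edges (v # ys)"
    using cycle_edges_rotate[of us "v # vs"] by (simp add: xs ys_def)
  have d: "distinct (v # ys)" "length ys \<ge> 2" using assms by (auto simp: xs ys_def)
  then obtain a b zs where ys: "ys = a # b # zs" by (cases ys rule: path_edges.cases) auto
  have "{e \<in> cycle_edges (v # ys). v \<in> e} = {{v, a}, {v, last ys}}"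
    using d Union_path_edges_subset[of ys] by (auto simp: cycle_edges_def ys)
  moreover have "a \<noteq> last ys" using d by (auto simp: ys)
  hence "{v, a} \<noteq> {v, last ys}" by (auto simp: doubleton_eq_iff)
  ultimately show ?thesis by (simp add: C vdegree_def)
qed

lemma is_cycle_vdegree: "is_cycle C \<Longrightarrow> v \<in> \<Union>C \<Longrightarrow> vdegree C v = 2"
  unfolding is_cycle_iff
  by (metis Union_cycle_edges cycle_vdegree list.size(3) not_numeral_le_zero)

lemma is_cycle_finite: "is_cycle C \<Longrightarrow> finite C"
  unfolding is_cycle_iff by auto

lemma is_cycle_nonempty: "is_cycle C \<Longrightarrow> C \<noteq> {}"
  unfolding is_cycle_iff cycle_edges_def by auto

lemma is_cycle_card_edge:
  assumes "is_cycle C" "e \<in> C" shows "card e = 2"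
proof -
  obtain xs where xs: "distinct xs" "3 \<le> length xs" "C = cycle_edges xs"
    using assms is_cycle_iff by blast
  obtain a b c zs where "xs = a # b # c # zs"
    using xs(2) by (metis One_nat_def Suc_le_length_iff numeral_3_eq_3)
  hence "last xs \<noteq> hd xs" using xs(1) by auto
  thus ?thesis using assms(2) xs path_edges_card by (auto simp: cycle_edges_def)
qed

section \<open>Even graphs as edge-disjoint unions of cycles\<close>

lemma complete_edges_iff: "e \<in> complete_edges V \<longleftrightarrow> (\<exists>a b. e = {a, b} \<and> a \<noteq> b \<and> a \<in> V \<and> b \<in> V)"
  by (auto simp: complete_edges_def card_2_iff)

lemma finite_complete_edges [simp]: "finite V \<Longrightarrow> finite (complete_edges V)"
  by (rule finite_subset[of _ "Pow V"]) (auto simp: complete_edges_def)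

lemma complete_edges_mono: "U \<subseteq> V \<Longrightarrow> complete_edges U \<subseteq> complete_edges V"
  by (auto simp: complete_edges_def)

text \<open>The first vertex of a longest path has a second neighbour, which must lie on the path.\<close>

lemma exists_cycle:
  assumes fin: "finite D" and card2: "\<And>e. e \<in> D \<Longrightarrow> card e = 2" and "D \<noteq> {}"
    and no_leaf: "\<And>v. vdegree D v \<noteq> 1"
  shows "\<exists>C\<subseteq>D. is_cycle C"
proof -
  define P where "P xs \<longleftrightarrow> distinct xs \<and> path_edges xs \<subseteq> D \<and> 2 \<le> length xs \<and> set xs \<subseteq> \<Union>D" for xs
  obtain a b where ab: "{a, b} \<in> D" "a \<noteq> b"
    using \<open>D \<noteq> {}\<close> card2 by (metis card_2_iff ex_in_conv)
  have finU: "finite (\<Union>D)" using fin card2 by (metis card.infinite finite_Union zero_neq_numeral)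
  have "P [a, b]" using ab by (auto simp: P_def)
  moreover have "length xs \<le> card (\<Union>D)" if "P xs" for xs
    using that finU by (metis P_def card_mono distinct_card)
  ultimately obtain xs where xs: "P xs" and max: "\<And>ys. P ys \<Longrightarrow> length ys \<le> length xs"
    using ex_has_greatest_nat[of P "[a, b]" length "Suc (card (\<Union>D))"] by (auto simp: le_imp_less_Suc)
  then obtain x y zs where xs_eq: "xs = x # y # zs"
    by (cases xs rule: path_edges.cases) (auto simp: P_def)
  have xy: "{x, y} \<in> D" "x \<noteq> y" using xs by (auto simp: P_def xs_eq)
  obtain e where e: "e \<in> D" "x \<in> e" "e \<noteq> {x, y}"
  proof (rule ccontr)
    assume "\<not> thesis"
    hence "{e \<in> D. x \<in> e} = {{x, y}}" using that xy by blast
    hence "vdegree D x = card {{x, y}}" by (simp only: vdegree_def)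
    thus False using no_leaf[of x] by simp
  qed
  then obtain z where z: "e = {x, z}" "x \<noteq> z" using card2[OF e(1)] by (auto simp: card_2_iff)
  hence zy: "z \<noteq> y" using e by auto
  have "z \<in> set xs"
  proof (rule ccontr)
    assume "z \<notin> set xs"
    hence "P (z # xs)" using xs e z by (auto simp: P_def xs_eq insert_commute)
    thus False using max by fastforce
  qed
  hence "z \<in> set zs" using z zy by (auto simp: xs_eq)
  then obtain us vs where zs: "zs = us @ z # vs" by (meson split_list)
  \<comment> \<open>The initial segment of the path up to \<open>z\<close> is closed by
    \<open>e\<close>. Since \<open>z\<close> differs from \<open>y\<close>, it has at least three
    vertices.\<close>
  define ys where "ys = x # y # us @ [z]"
  have "xs = ys @ vs" "ys \<noteq> []" by (simp_all add: ys_def xs_eq zs)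
  hence "path_edges ys \<subseteq> path_edges xs"
    by (cases "vs = []") (auto simp: path_edges_append)
  hence "path_edges ys \<subseteq> D" using xs by (auto simp: P_def)
  hence "cycle_edges ys \<subseteq> D" using e z by (auto simp: cycle_edges_def ys_def insert_commute)
  moreover have "distinct ys" "3 \<le> length ys" using xs by (auto simp: P_def ys_def xs_eq zs)
  ultimately show ?thesis unfolding is_cycle_iff by blast
qed

text \<open>A nonempty even graph has no vertex of degree 1 and hence contains a cycle. Removing it
  lowers the degrees on it by 2, so the rest is even and the induction applies.\<close>

lemma even_graph_decomposition:
  assumes "finite D" "\<forall>e\<in>D. card e = 2" "\<forall>v. even (vdegree D v)"
  shows "\<exists>\<C>. finite \<C> \<and> (\<forall>C\<in>\<C>. is_cycle C) \<and> disjoint \<C> \<and> \<Union>\<C> = D"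
  using assms
proof (induction D rule: finite_psubset_induct)
  case (psubset D)
  show ?case
  proof (cases "D = {}")
    case True
    thus ?thesis by (intro exI[of _ "{}"]) auto
  next
    case False
    have "\<exists>C\<subseteq>D. is_cycle C"
    proof (rule exists_cycle)
      show "vdegree D v \<noteq> 1" for v using psubset.prems(2) by (metis odd_one)
    qed (use psubset False in auto)
    then obtain C where C: "C \<subseteq> D" "is_cycle C" by blast
    have "even (vdegree C v)" for v
      using is_cycle_vdegree[OF C(2), of v] vdegree_eq_0_iff[OF is_cycle_finite[OF C(2)], of v]
      by (cases "v \<in> \<Union>C") auto
    hence "even (vdegree (D - C) v)" for v
      using psubset C vdegree_mono[OF psubset.hyps C(1), of v] by (simp add: vdegree_diff)
    moreover have "D - C \<subset> D" using is_cycle_nonempty[OF C(2)] C(1) by auto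
    moreover have "\<forall>e\<in>D - C. card e = 2" using psubset.prems(1) by blast
    ultimately obtain \<C> where *: "finite \<C>" "\<forall>C\<in>\<C>. is_cycle C" "disjoint \<C>" "\<Union>\<C> = D - C"
      using psubset.IH[of "D - C"] by meson
    have "disjoint (insert C \<C>)"
      using *(3,4) by (auto simp: pairwise_insert disjnt_def)
    thus ?thesis using * C by (intro exI[of _ "insert C \<C>"]) auto
  qed
qed

text \<open>Vertex-disjointness puts all edges at \<open>v\<close> into a single cycle. Conversely,
  the cycles of an edge-disjoint decomposition are vertex-disjoint, because a vertex on two of them
  would have degree 4.\<close>

lemma two_factor_on_iff:
  assumes "finite V"
  shows "two_factor_on V H \<longleftrightarrow> H \<subseteq> complete_edges V \<and> (\<forall>v\<in>V. vdegree H v = 2)"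
proof
  assume "two_factor_on V H"
  then obtain \<C> where \<C>: "\<And>C. C \<in> \<C> \<Longrightarrow> is_cycle C" "disjoint_family_on Union \<C>" "H = \<Union>\<C>" "\<Union>H = V"
    unfolding two_factor_on_def by blast
  have "vdegree H v = 2" if v: "v \<in> V" for v
  proof -
    obtain C where C: "C \<in> \<C>" "v \<in> \<Union>C" using v \<C> by blast
    have "{e \<in> H. v \<in> e} = {e \<in> C. v \<in> e}"
    proof (intro equalityI subsetI)
      fix e assume "e \<in> {e \<in> H. v \<in> e}"
      then obtain C' where "C' \<in> \<C>" "e \<in> C'" "v \<in> e" using \<C>(3) by blast
      moreover from this have "C' = C" using C \<C>(2) unfolding disjoint_family_on_def by blast
      ultimately show "e \<in> {e \<in> C. v \<in> e}" by auto
    qed (use C \<C>(3) in auto)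
    thus ?thesis using is_cycle_vdegree[OF \<C>(1)[OF C(1)] C(2)] by (simp add: vdegree_def)
  qed
  moreover have "H \<subseteq> complete_edges V"
    using \<C> is_cycle_card_edge unfolding complete_edges_def by blast
  ultimately show "H \<subseteq> complete_edges V \<and> (\<forall>v\<in>V. vdegree H v = 2)" by blast
next
  assume H: "H \<subseteq> complete_edges V \<and> (\<forall>v\<in>V. vdegree H v = 2)"
  have fin: "finite H" using H assms finite_subset by fastforce
  have U: "\<Union>H = V"
  proof
    show "\<Union>H \<subseteq> V" using H by (auto simp: complete_edges_def)
    show "V \<subseteq> \<Union>H" using H vdegree_eq_0_iff[OF fin] by fastforce
  qed
  have "even (vdegree H v)" for v using H vdegree_eq_0_iff[OF fin, of v] U by (cases "v \<in> V") auto
  then obtain \<C> where \<C>: "finite \<C>" "\<forall>C\<in>\<C>. is_cycle C" "disjoint \<C>" "\<Union>\<C> = H"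
    using even_graph_decomposition[OF fin] H by (auto simp: complete_edges_def subset_eq)
  have "\<Union>C \<inter> \<Union>C' = {}" if C: "C \<in> \<C>" "C' \<in> \<C>" "C \<noteq> C'" for C C'
  proof (rule ccontr)
    assume "\<Union>C \<inter> \<Union>C' \<noteq> {}"
    then obtain v where v: "v \<in> \<Union>C" "v \<in> \<Union>C'" by blast
    have "C \<inter> C' = {}" using \<C>(3) C by (meson disjointD)
    hence "vdegree (C \<union> C') v = 4"
      using C v \<C>(2) by (simp add: vdegree_Un is_cycle_finite is_cycle_vdegree)
    moreover have "vdegree (C \<union> C') v \<le> vdegree H v" using C \<C>(4) by (intro vdegree_mono fin) auto
    moreover have "v \<in> V" using v C \<C>(4) U by blast
    ultimately show False using H by auto
  qed
  thus "two_factor_on V H" unfolding two_factor_on_def disjoint_family_on_def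
    using \<C> U by blast
qed

section \<open>Counting 2-factors that contain a cycle\<close>

lemma finite_two_factors: "finite V \<Longrightarrow> finite {H. two_factor_on V H}"
  by (rule finite_subset[of _ "Pow (complete_edges V)"]) (auto simp: two_factor_on_iff)

lemma two_factor_on_Union: "two_factor_on V H \<Longrightarrow> \<Union>H = V"
  unfolding two_factor_on_def by blast

lemma two_factor_on_subset: "finite V \<Longrightarrow> two_factor_on V H \<Longrightarrow> H \<subseteq> complete_edges V"
  by (simp add: two_factor_on_iff)

lemma two_factor_on_finite: "finite V \<Longrightarrow> two_factor_on V H \<Longrightarrow> finite H"
  by (meson finite_complete_edges finite_subset two_factor_on_subset)

text \<open>Double counting of incidences: every vertex lies on two edges and every edge has two
  ends.\<close>

lemma card_two_factor:
  assumes "finite V" "two_factor_on V H"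
  shows "card H = card V"
proof -
  have H: "H \<subseteq> complete_edges V" "\<forall>v\<in>V. vdegree H v = 2" "finite H"
    using assms two_factor_on_iff two_factor_on_finite by auto
  have "{v \<in> V. v \<in> e} = e" if "e \<in> H" for e
    using H(1) that by (auto simp: complete_edges_def)
  hence "(\<Sum>v\<in>V. card {e \<in> H. v \<in> e}) = 2 * card H"
    using H by (intro sum_multicount assms(1)) (auto simp: complete_edges_def)
  moreover have "(\<Sum>v\<in>V. card {e \<in> H. v \<in> e}) = 2 * card V"
    using H(2) by (simp add: vdegree_def)
  ultimately show ?thesis by simp
qed

lemma is_cycle_two_factor: "is_cycle C \<Longrightarrow> two_factor_on (\<Union>C) C"
  unfolding two_factor_on_def by (intro exI[of _ "{C}"]) (auto simp: disjoint_family_on_def)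

lemma is_cycle_finite_Union: "is_cycle C \<Longrightarrow> finite (\<Union>C)"
  by (metis is_cycle_finite is_cycle_card_edge card.infinite finite_Union zero_neq_numeral)

lemma is_cycle_card: "is_cycle C \<Longrightarrow> card (\<Union>C) = card C"
  using card_two_factor is_cycle_two_factor is_cycle_finite_Union by metis

text \<open>Each pair of a 2-factor and one of its edges gives a 2-factor with one more vertex, by
  subdividing the edge.\<close>

lemma card_two_factors_insert:
  assumes V: "finite V" "x \<notin> V"
  shows "card V * card {H. two_factor_on V H} \<le> card {H. two_factor_on (insert x V) H}"
proof -
  let ?P = "SIGMA H:{H. two_factor_on V H}. H"
  define g where "g = (\<lambda>(H, e). (H - {e}) \<union> (\<lambda>a. {a, x}) ` e)"
  have inj: "inj_on g ?P"
  proof (rule inj_on_inverseI)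
    fix He assume "He \<in> ?P"
    then obtain H e where He: "He = (H, e)" "two_factor_on V H" "e \<in> H" by auto
    have "x \<notin> e'" if "e' \<in> H" for e' using two_factor_on_Union[OF He(2)] that V(2) by auto
    \<comment> \<open>The subdivided edge is recovered as the set of neighbours of \<open>x\<close>,
      and the other edges of \<open>H\<close> as those that avoid \<open>x\<close>.\<close>
    hence "{a. a \<noteq> x \<and> {a, x} \<in> g He} = e" "{f \<in> g He. x \<notin> f} = H - {e}"
      using He by (auto simp: g_def doubleton_eq_iff)
    thus "(\<lambda>G. let e = {a. a \<noteq> x \<and> {a, x} \<in> G} in (insert e {f \<in> G. x \<notin> f}, e)) (g He) = He"
      using He by (auto simp: Let_def)
  qed
  have "g ` ?P \<subseteq> {H. two_factor_on (insert x V) H}"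
  proof safe
    fix H e assume He: "two_factor_on V H" "e \<in> H"
    have H: "H \<subseteq> complete_edges V" "\<forall>v\<in>V. vdegree H v = 2" "finite H"
      using He V two_factor_on_iff two_factor_on_finite by auto
    obtain a b where e: "e = {a, b}" "a \<noteq> b" "a \<in> V" "b \<in> V"
      using H(1) He(2) complete_edges_iff by blast
    have x: "x \<notin> f" if "f \<in> H" for f using H(1) that V(2) by (auto simp: complete_edges_def)
    have g: "g (H, e) = insert {a, x} (insert {b, x} (H - {e}))" by (auto simp: g_def e)
    have "a \<noteq> x" "b \<noteq> x" using e V by auto
    hence new: "{a, x} \<notin> insert {b, x} (H - {e})" "{b, x} \<notin> H - {e}"
      using x e by (auto simp: doubleton_eq_iff)
    have "vdegree (H - {e}) v = vdegree H v - (if v \<in> e then 1 else 0)" for v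
      using vdegree_diff[of H "{e}" v] H He vdegree_insert[of "{}" e v] by simp
    hence deg: "vdegree (g (H, e)) v = vdegree H v - (if v \<in> e then 1 else 0)
        + (if v \<in> {b, x} then 1 else 0) + (if v \<in> {a, x} then 1 else 0)" for v
      unfolding g using new H by (simp add: vdegree_insert)
    have "vdegree H x = 0" using vdegree_eq_0_iff[OF H(3)] x by auto
    hence "\<forall>v\<in>insert x V. vdegree (g (H, e)) v = 2"
      unfolding deg using H(2) e \<open>a \<noteq> x\<close> \<open>b \<noteq> x\<close> V(2) by auto
    moreover have "g (H, e) \<subseteq> complete_edges (insert x V)"
      unfolding g using H(1) e V(2) \<open>a \<noteq> x\<close> \<open>b \<noteq> x\<close> by (auto simp: complete_edges_def)
    ultimately show "two_factor_on (insert x V) (g (H, e))"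
      using V by (simp add: two_factor_on_iff)
  qed
  hence "card ?P \<le> card {H. two_factor_on (insert x V) H}"
    using card_inj_on_le[OF inj] finite_two_factors V by simp
  moreover have "card ?P = (\<Sum>H\<in>{H. two_factor_on V H}. card H)"
    using V finite_two_factors two_factor_on_finite by (intro card_SigmaI) auto
  moreover have "\<dots> = card V * card {H. two_factor_on V H}"
    using card_two_factor[OF V(1)] by simp
  ultimately show ?thesis by simp
qed

text \<open>The vertices of \<open>W\<close> are inserted one at a time: with
  \<open>card U + i\<close> vertices present there are equally many edges to subdivide.\<close>

lemma card_two_factors_Un:
  assumes "finite W" "finite U" "U \<inter> W = {}"
  shows "(\<Prod>i<card W. card U + i) * card {H. two_factor_on U H} \<le> card {H. two_factor_on (U \<union> W) H}"
  using assms
proof (induction W rule: finite_induct)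
  case (insert x W)
  have "(\<Prod>i<card (insert x W). card U + i) * card {H. two_factor_on U H}
      = (card U + card W) * ((\<Prod>i<card W. card U + i) * card {H. two_factor_on U H})"
    using insert.hyps by simp
  also have "\<dots> \<le> (card U + card W) * card {H. two_factor_on (U \<union> W) H}"
    using insert by (intro mult_left_mono) auto
  also have "\<dots> = card (U \<union> W) * card {H. two_factor_on (U \<union> W) H}"
    using insert by (subst card_Un_disjoint) auto
  also have "\<dots> \<le> card {H. two_factor_on (insert x (U \<union> W)) H}"
    using insert by (intro card_two_factors_insert) auto
  finally show ?case by simp
qed auto

text \<open>At a vertex of \<open>C\<close> both edges of \<open>H\<close> belong to
  \<open>C\<close>, so no edge of \<open>H - C\<close> touches the cycle.\<close>

lemma two_factor_on_remove_cycle: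
  assumes V: "finite V" "two_factor_on V H" and C: "is_cycle C" "C \<subseteq> H"
  shows "two_factor_on (V - \<Union>C) (H - C)"
proof -
  have H: "H \<subseteq> complete_edges V" "\<forall>v\<in>V. vdegree H v = 2" "finite H"
    using V two_factor_on_iff two_factor_on_finite by auto
  have deg: "vdegree (H - C) v = vdegree H v - vdegree C v" for v
    using H C by (simp add: vdegree_diff)
  have "\<Union>C \<subseteq> V" using C(2) H(1) by (auto simp: complete_edges_def)
  have 0: "vdegree C v = 0" if "v \<notin> \<Union>C" for v
    using vdegree_eq_0_iff[OF is_cycle_finite[OF C(1)]] that by blast
  have "vdegree (H - C) v = 0" if "v \<in> \<Union>C" for v
    using H(2) is_cycle_vdegree[OF C(1) that] \<open>\<Union>C \<subseteq> V\<close> that by (auto simp: deg)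
  hence "\<Union>C \<inter> \<Union>(H - C) = {}"
    using vdegree_eq_0_iff[of "H - C"] H(3) by (metis disjoint_iff finite_Diff)
  hence "H - C \<subseteq> complete_edges (V - \<Union>C)"
    using H(1) by (auto simp: complete_edges_def)
  moreover have "\<forall>v\<in>V - \<Union>C. vdegree (H - C) v = 2" using H(2) 0 by (auto simp: deg)
  ultimately show ?thesis using V by (simp add: two_factor_on_iff)
qed

text \<open>With \<open>k = card V\<close>, a pair is described by a list of the cycle's vertices
  and a 2-factor on the other \<open>k - j\<close> vertices. Reinserting the listed vertices by
  subdivision bounds the number of such 2-factors by \<open>T V\<close> divided by
  \<open>(k - j) ... (k - 1)\<close>, and there are \<open>(k - j + 1) ... k\<close> lists, which
  leaves the ratio \<open>k / (k - j)\<close>.\<close>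

lemma card_two_factors_with_cycle:
  fixes V j
  defines "N \<equiv> card {(H, C). two_factor_on V H \<and> is_cycle C \<and> C \<subseteq> H \<and> card C = j}"
  assumes V: "finite V" and j: "0 < j" "j < card V"
  shows "N * (card V - j) \<le> card V * card {H. two_factor_on V H}"
proof -
  define k where "k = card V"
  define T where "T U = card {H. two_factor_on U H}" for U
  define L where "L = {xs. length xs = j \<and> distinct xs \<and> set xs \<subseteq> V}"
  define S where "S = (SIGMA xs:L. {H. two_factor_on (V - set xs) H})"
  have finL: "finite L"
    by (rule finite_subset[OF _ finite_lists_length_eq[OF V, of j]]) (auto simp: L_def)
  have finS: "finite S" using finL finite_two_factors V by (auto simp: S_def)
  have "N \<le> card S"
    unfolding N_def
  proof (rule surj_card_le[OF finS, where f = "\<lambda>(xs, H). (cycle_edges xs \<union> H, cycle_edges xs)"],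
      clarify)
    fix H C assume *: "two_factor_on V H" "is_cycle C" "C \<subseteq> H" "j = card C"
    obtain xs where xs: "distinct xs" "3 \<le> length xs" "C = cycle_edges xs"
      using * is_cycle_iff by blast
    have U: "\<Union>C = set xs" using xs by (subst xs(3), intro Union_cycle_edges) auto
    have "length xs = j" using is_cycle_card[OF *(2)] U *(4) xs(1) by (simp add: distinct_card)
    moreover have "set xs \<subseteq> V" using U *(3) two_factor_on_Union[OF *(1)] by blast
    moreover have "two_factor_on (V - set xs) (H - C)"
      using two_factor_on_remove_cycle[OF V *(1,2,3)] by (simp add: U)
    ultimately show "(H, C) \<in> (\<lambda>(xs, H). (cycle_edges xs \<union> H, cycle_edges xs)) ` S"
      using xs *(3) by (intro image_eqI[of _ _ "(xs, H - C)"]) (auto simp: S_def L_def)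
  qed
  also have "card S = (\<Sum>xs\<in>L. T (V - set xs))"
    unfolding S_def T_def using finL finite_two_factors V by (intro card_SigmaI) auto
  finally have N: "N \<le> (\<Sum>xs\<in>L. T (V - set xs))" .
  have insert: "(\<Prod>i<j. k - j + i) * T (V - set xs) \<le> T V" if "xs \<in> L" for xs
  proof -
    have "set xs \<subseteq> V" "card (set xs) = j" using that by (auto simp: L_def distinct_card)
    moreover have "(V - set xs) \<inter> set xs = {}" by blast
    ultimately show ?thesis
      using card_two_factors_Un[of "set xs" "V - set xs"] V
      by (simp add: T_def k_def card_Diff_subset Un_absorb2)
  qed
  obtain i where i: "j = Suc i" using j(1) gr0_implies_Suc by blast
  \<comment> \<open>\<open>A\<close> is \<open>(k - j + 1) ... (k - 1)\<close>, the common factor of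
    the two products that are compared.\<close>
  define A where "A = (\<Prod>l<i. k - j + Suc l)"
  have "(\<Prod>l<j. k - j + l) = (k - j) * A"
    unfolding A_def i by (simp only: prod.lessThan_Suc_shift) simp
  moreover have "card L = (\<Prod>l<j. k - j + Suc l)"
  proof -
    have "card L = \<Prod>{k - j + 1..k}"
      using j V unfolding L_def k_def by (intro card_lists_distinct_length_eq) auto
    also have "\<dots> = (\<Prod>l<j. k - j + Suc l)"
      using j by (intro prod.reindex_bij_witness[of _ "\<lambda>l. k - j + Suc l" "\<lambda>l. l - (k - j) - 1"])
        (auto simp: k_def)
    finally show ?thesis .
  qed
  hence "card L = A * (k - j + j)"
    unfolding A_def i by (simp only: prod.lessThan_Suc)
  hence "card L = A * k"
    using j by (simp add: k_def)
  ultimately have "N * ((k - j) * A) \<le> A * k * T V"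
  proof -
    have "N * ((k - j) * A) \<le> (\<Sum>xs\<in>L. T (V - set xs)) * (\<Prod>l<j. k - j + l)"
      using N \<open>(\<Prod>l<j. k - j + l) = (k - j) * A\<close> by simp
    also have "\<dots> \<le> (\<Sum>xs\<in>L. T V)"
      unfolding sum_distrib_right using insert by (intro sum_mono) (simp add: mult.commute)
    finally show ?thesis using \<open>card L = A * k\<close> by simp
  qed
  moreover have "0 < A" unfolding A_def by (intro prod_pos) auto
  ultimately have "A * (N * (k - j)) \<le> A * (k * T V)" by (simp add: algebra_simps)
  thus ?thesis using \<open>0 < A\<close> by (simp add: k_def T_def)
qed

text \<open>If \<open>d = card V - j\<close> is positive, then
  \<open>j + d \<le> (1 + j) * d\<close> bounds the ratio \<open>card V / d\<close>. If
  \<open>j\<close> is at least \<open>card V\<close>, the cycle has to be the whole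
  2-factor.\<close>

lemma card_two_factors_with_cycle_le:
  assumes V: "finite V" and j: "0 < j"
  shows "card {(H, C). two_factor_on V H \<and> is_cycle C \<and> C \<subseteq> H \<and> card C = j}
           \<le> (1 + j) * card {H. two_factor_on V H}" (is "card ?S \<le> (1 + j) * ?T")
proof -
  consider "j < card V" | "card V \<le> j" by linarith
  thus ?thesis
  proof cases
    case 1
    define d where "d = card V - j"
    have d: "0 < d" "card V = j + d" using 1 by (auto simp: d_def)
    have "card ?S * d \<le> card V * ?T"
      using card_two_factors_with_cycle[OF V j 1] by (simp add: d_def)
    also have "\<dots> \<le> ((1 + j) * d) * ?T"
      using d by (intro mult_right_mono) (auto simp: algebra_simps)
    finally have "d * card ?S \<le> d * ((1 + j) * ?T)" by (simp only: mult_ac)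
    thus ?thesis using d(1) by (simp only: mult_le_cancel1)
  next
    case 2
    have "?S \<subseteq> (\<lambda>H. (H, H)) ` {H. two_factor_on V H}"
    proof clarify
      fix H C assume *: "two_factor_on V H" "is_cycle C" "C \<subseteq> H" "j = card C"
      hence "C = H"
        using 2 card_two_factor[OF V *(1)] two_factor_on_finite[OF V *(1)] by (metis card_seteq)
      thus "(H, C) \<in> (\<lambda>H. (H, H)) ` {H. two_factor_on V H}" using * by auto
    qed
    hence "card ?S \<le> ?T"
      using surj_card_le[OF finite_two_factors[OF V]] by blast
    thus ?thesis by simp
  qed
qed

lemma is_cycle_card_ge: "is_cycle C \<Longrightarrow> 3 \<le> card C"
  using is_cycle_card unfolding is_cycle_iff
  by (metis Union_cycle_edges distinct_card is_cycle_iff list.size(3) not_numeral_le_zero)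

text \<open>The pairs of a 2-factor and a cycle in it are grouped by the length of the cycle. After
  division by the number of 2-factors this bounds the mean weight of the cycles inside a uniformly
  random \<open>H\<close>.\<close>

lemma sum_weight_cycles_in_two_factors:
  fixes y :: real
  assumes V: "finite V" and y: "0 \<le> y"
  shows "(\<Sum>H | two_factor_on V H. \<Sum>C | is_cycle C \<and> C \<subseteq> H. y ^ card C)
           \<le> (\<Sum>j=3..card V. real (1 + j) * y ^ j) * card {H. two_factor_on V H}"
proof -
  let ?S = "SIGMA H:{H. two_factor_on V H}. {C. is_cycle C \<and> C \<subseteq> H}"
  have finC: "finite {C. is_cycle C \<and> C \<subseteq> H}" if "two_factor_on V H" for H
    using two_factor_on_finite[OF V that] by (auto intro: finite_subset[of _ "Pow H"])
  have finS: "finite ?S" using finC finite_two_factors[OF V] by auto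
  have "(\<Sum>H | two_factor_on V H. \<Sum>C | is_cycle C \<and> C \<subseteq> H. y ^ card C) = (\<Sum>p\<in>?S. y ^ card (snd p))"
    using finC finite_two_factors[OF V] by (subst sum.Sigma) (auto intro!: sum.cong)
  also have "\<dots> = (\<Sum>j=3..card V. \<Sum>p | p \<in> ?S \<and> card (snd p) = j. y ^ card (snd p))"
  proof (rule sum.group[OF finS, symmetric])
    have "3 \<le> card C \<and> card C \<le> card V" if "two_factor_on V H" "is_cycle C" "C \<subseteq> H" for H C
      using that card_two_factor[OF V] two_factor_on_finite[OF V] is_cycle_card_ge
      by (metis card_mono)
    thus "(\<lambda>p. card (snd p)) ` ?S \<subseteq> {3..card V}" by auto
  qed auto
  also have "\<dots> = (\<Sum>j=3..card V. real (card {(H, C). two_factor_on V H \<and> is_cycle C \<and> C \<subseteq> H \<and> card C = j}) * y ^ j)"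
  proof (rule sum.cong)
    fix j
    have "{p. p \<in> ?S \<and> card (snd p) = j} = {(H, C). two_factor_on V H \<and> is_cycle C \<and> C \<subseteq> H \<and> card C = j}"
      by auto
    moreover have "(\<Sum>p | p \<in> ?S \<and> card (snd p) = j. y ^ card (snd p))
        = (\<Sum>p | p \<in> ?S \<and> card (snd p) = j. y ^ j)"
      by (rule sum.cong) auto
    ultimately show "(\<Sum>p | p \<in> ?S \<and> card (snd p) = j. y ^ card (snd p))
        = real (card {(H, C). two_factor_on V H \<and> is_cycle C \<and> C \<subseteq> H \<and> card C = j}) * y ^ j"
      by simp
  qed simp
  also have "\<dots> \<le> (\<Sum>j=3..card V. (real (1 + j) * card {H. two_factor_on V H}) * y ^ j)"
  proof (intro sum_mono mult_right_mono)
    fix j assume "j \<in> {3..card V}"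
    hence "0 < j" by auto
    from card_two_factors_with_cycle_le[OF V this]
    show "real (card {(H, C). two_factor_on V H \<and> is_cycle C \<and> C \<subseteq> H \<and> card C = j})
        \<le> real (1 + j) * card {H. two_factor_on V H}"
      by (simp only: of_nat_mult[symmetric] of_nat_le_iff)
  qed (use y in auto)
  also have "\<dots> = (\<Sum>j=3..card V. real (1 + j) * y ^ j) * card {H. two_factor_on V H}"
    unfolding sum_distrib_right by (intro sum.cong refl) (simp only: mult_ac)
  finally show ?thesis .
qed

section \<open>A weighted union bound over 2-factors\<close>

text \<open>Repeated edges count with multiplicity, unlike in \<open>prod w (path_edges xs)\<close>.
  Hence a sum over all walks, including those that revisit vertices, factors step by step.\<close>

fun path_weight :: "('a set \<Rightarrow> real) \<Rightarrow> 'a list \<Rightarrow> real" where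
  "path_weight w [] = 1"
| "path_weight w [x] = 1"
| "path_weight w (x # y # zs) = w {x, y} * path_weight w (y # zs)"

lemma path_weight_nonneg: "(\<And>e. 0 \<le> w e) \<Longrightarrow> 0 \<le> path_weight w xs"
  by (induction xs rule: path_edges.induct) auto

lemma prod_path_edges: "distinct xs \<Longrightarrow> prod w (path_edges xs) = path_weight w xs"
proof (induction xs rule: path_edges.induct)
  case (3 x y zs)
  have "x \<notin> \<Union>(path_edges (y # zs))"
    using Union_path_edges_subset[of "y # zs"] 3(2) by auto
  hence "{x, y} \<notin> path_edges (y # zs)" by blast
  thus ?case using 3 by simp
qed auto

lemma prod_cycle_edges:
  assumes "distinct xs" "3 \<le> length xs"
  shows "prod w (cycle_edges xs) = w {last xs, hd xs} * path_weight w xs"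
proof -
  obtain x y z zs where xs: "xs = x # y # z # zs"
    using assms(2) by (metis Suc_le_length_iff numeral_3_eq_3)
  have "x \<notin> \<Union>(path_edges (y # z # zs))"
    using Union_path_edges_subset[of "y # z # zs"] assms(1) xs by auto
  moreover have "last xs \<noteq> y" "last xs \<noteq> x" using assms(1) xs by auto
  ultimately have "{last xs, hd xs} \<notin> path_edges xs"
    unfolding xs by (auto simp: doubleton_eq_iff)
  thus ?thesis using prod_path_edges[OF assms(1)] by (simp add: cycle_edges_def)
qed

lemma sum_lists_Suc:
  "(\<Sum>xs | set xs \<subseteq> N \<and> length xs = Suc m. f xs)
     = (\<Sum>x\<in>N. \<Sum>xs | set xs \<subseteq> N \<and> length xs = m. f (x # xs))"
proof -
  have "(\<Sum>xs | set xs \<subseteq> N \<and> length xs = Suc m. f xs)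
      = (\<Sum>(xs, x)\<in>{xs. set xs \<subseteq> N \<and> length xs = m} \<times> N. f (x # xs))"
    unfolding lists_length_Suc_eq by (subst sum.reindex) (auto simp: case_prod_unfold inj_on_def)
  also have "\<dots> = (\<Sum>x\<in>N. \<Sum>xs | set xs \<subseteq> N \<and> length xs = m. f (x # xs))"
    by (subst sum.swap) (simp add: sum.cartesian_product)
  finally show ?thesis .
qed

text \<open>\<open>Q\<close> bounds the total weight of the possible next steps from any vertex, so
  each of the \<open>m\<close> steps costs at most a factor \<open>Q\<close>.\<close>

lemma sum_path_weight_le:
  assumes w: "\<And>e. 0 \<le> w e" and Q: "\<And>x. (\<Sum>z\<in>N. w {x, z}) \<le> Q"
  shows "(\<Sum>xs | set xs \<subseteq> N \<and> length xs = m. path_weight w (x # xs)) \<le> Q ^ m"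
proof (induction m arbitrary: x)
  case 0
  have "{xs. set xs \<subseteq> N \<and> length xs = 0} = {[]}" by auto
  thus ?case by simp
next
  case (Suc m)
  have "0 \<le> Q" using Q[of x] sum_nonneg[of N "\<lambda>z. w {x, z}"] w by force
  have "(\<Sum>xs | set xs \<subseteq> N \<and> length xs = Suc m. path_weight w (x # xs))
      = (\<Sum>z\<in>N. w {x, z} * (\<Sum>xs | set xs \<subseteq> N \<and> length xs = m. path_weight w (z # xs)))"
    by (simp add: sum_lists_Suc sum_distrib_left)
  also have "\<dots> \<le> (\<Sum>z\<in>N. w {x, z} * Q ^ m)"
    by (intro sum_mono mult_left_mono Suc w)
  also have "\<dots> \<le> Q * Q ^ m"
    unfolding sum_distrib_right[symmetric] using Q \<open>0 \<le> Q\<close> by (intro mult_right_mono) auto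
  finally show ?case by simp
qed

text \<open>At most two of the \<open>z\<close> are neighbours of \<open>x\<close> in
  \<open>H\<close>, each contributing \<open>y\<close>; in addition \<open>q\<close> is charged for
  every \<open>z\<close>.\<close>

lemma sum_neighbour_weight_le:
  fixes y q :: real
  assumes N: "finite N" and H: "finite H" "vdegree H x \<le> 2" and yq: "0 \<le> y" "0 \<le> q"
  shows "(\<Sum>z\<in>N. if {x, z} \<in> H then y else q) \<le> 2 * y + card N * q"
proof -
  have "card {z \<in> N. {x, z} \<in> H} \<le> vdegree H x"
    unfolding vdegree_def
    by (rule card_inj_on_le[where f = "\<lambda>z. {x, z}"])
      (use H in \<open>auto simp: inj_on_def doubleton_eq_iff\<close>)
  hence nb: "real (card {z \<in> N. {x, z} \<in> H}) \<le> 2" using H(2) by linarith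
  have "(\<Sum>z\<in>N. if {x, z} \<in> H then y else q) \<le> (\<Sum>z\<in>N. (if {x, z} \<in> H then y else 0) + q)"
    using yq by (intro sum_mono) auto
  also have "\<dots> = card {z \<in> N. {x, z} \<in> H} * y + card N * q"
    by (simp add: sum.distrib sum.inter_filter[OF N, symmetric])
  also have "\<dots> \<le> 2 * y + card N * q"
    using mult_right_mono[OF nb yq(1)] by simp
  finally show ?thesis .
qed

text \<open>Rotating such a cycle so that its closing edge lies outside \<open>H\<close> makes the last step
  deterministic, which saves a factor \<open>card N\<close>.\<close>

lemma sum_weight_cycles_not_subset:
  fixes y q :: real
  assumes N: "finite N" and H: "finite H" "\<And>x. vdegree H x \<le> 2" and yq: "0 \<le> y" "0 \<le> q"
  shows "(\<Sum>C | is_cycle C \<and> C \<subseteq> complete_edges N \<and> \<not> C \<subseteq> H. \<Prod>e\<in>C. if e \<in> H then y else q)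
           \<le> (\<Sum>m=3..card N. card N * q * (2 * y + card N * q) ^ (m - 1))"
proof -
  define w where "w e = (if e \<in> H then y else q)" for e
  define Q where "Q = 2 * y + card N * q"
  define L where "L = {xs. set xs \<subseteq> N \<and> length xs \<in> {3..card N}}"
  have w: "0 \<le> w e" for e using yq by (simp add: w_def)
  have finL: "finite L"
    by (rule finite_subset[OF _ finite_lists_length_le[OF N, of "card N"]]) (auto simp: L_def)
  have fin: "finite {C. is_cycle C \<and> C \<subseteq> complete_edges N \<and> \<not> C \<subseteq> H}"
    by (rule finite_subset[of _ "Pow (complete_edges N)"]) (use N in auto)
  \<comment> \<open>Each cycle is charged to one list of its vertices whose closing edge, of weight
    \<open>q\<close>, lies outside \<open>H\<close>. Lists that arise from no cycle only enlarge the
    right-hand side.\<close>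
  have "(\<Sum>C | is_cycle C \<and> C \<subseteq> complete_edges N \<and> \<not> C \<subseteq> H. prod w C)
      \<le> (\<Sum>xs\<in>L. q * path_weight w xs)"
  proof (rule sum_le_included[where i = cycle_edges, OF fin finL]; intro ballI)
    fix xs show "0 \<le> q * path_weight w xs" using yq path_weight_nonneg[of w xs, OF w] by simp
  next
    fix C assume "C \<in> {C. is_cycle C \<and> C \<subseteq> complete_edges N \<and> \<not> C \<subseteq> H}"
    then obtain e where C: "is_cycle C" "C \<subseteq> complete_edges N" "e \<in> C" "e \<notin> H" by blast
    then obtain xs where xs: "distinct xs" "3 \<le> length xs" "C = cycle_edges xs"
      using is_cycle_iff by blast
    then obtain ys where ys: "cycle_edges ys = C" "mset ys = mset xs" "e = {last ys, hd ys}"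
      using rotate_edge_to_end C(3) by blast
    have ys': "distinct ys" "3 \<le> length ys"
      using xs ys(2) mset_eq_imp_distinct_iff[OF ys(2)] mset_eq_length[OF ys(2)] by auto
    have "set ys = \<Union>C" using ys ys' Union_cycle_edges[of ys] by force
    also have "\<dots> \<subseteq> N" using C(2) by (auto simp: complete_edges_def)
    finally have "set ys \<subseteq> N" .
    moreover from this have "length ys \<le> card N"
      using N ys'(1) by (metis card_mono distinct_card)
    ultimately have "ys \<in> L" using ys' by (simp add: L_def)
    moreover have "prod w C = q * path_weight w ys"
      using prod_cycle_edges[OF ys', of w] C(4) ys by (simp add: w_def)
    ultimately show "\<exists>ys\<in>L. cycle_edges ys = C \<and> prod w C \<le> q * path_weight w ys"
      using ys by auto
  qed
  also have "\<dots> = (\<Sum>m=3..card N. \<Sum>xs | xs \<in> L \<and> length xs = m. q * path_weight w xs)"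
    using finL by (intro sum.group[symmetric]) (auto simp: L_def)
  also have "\<dots> \<le> (\<Sum>m=3..card N. card N * q * Q ^ (m - 1))"
  proof (rule sum_mono)
    fix m assume m: "m \<in> {3..card N}"
    then obtain k where k: "m = Suc k" by (cases m) auto
    have "{xs. xs \<in> L \<and> length xs = m} = {xs. set xs \<subseteq> N \<and> length xs = Suc k}"
      using m by (auto simp: L_def k)
    hence "(\<Sum>xs | xs \<in> L \<and> length xs = m. q * path_weight w xs)
        = q * (\<Sum>x\<in>N. \<Sum>xs | set xs \<subseteq> N \<and> length xs = k. path_weight w (x # xs))"
      by (simp add: sum_lists_Suc sum_distrib_left)
    also have "\<dots> \<le> q * (\<Sum>x\<in>N. Q ^ k)"
    proof (intro mult_left_mono sum_mono sum_path_weight_le w yq)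
      show "(\<Sum>z\<in>N. w {x, z}) \<le> Q" for x
        unfolding w_def Q_def using sum_neighbour_weight_le[OF N H yq] .
    qed
    finally show "(\<Sum>xs | xs \<in> L \<and> length xs = m. q * path_weight w xs) \<le> card N * q * Q ^ (m - 1)"
      by (simp add: k mult_ac)
  qed
  finally show ?thesis by (simp add: w_def Q_def)
qed

section \<open>From the weights of cycles to the weights of 2-factors\<close>

lemma even_vdegree_two_factor:
  assumes "finite V" "two_factor_on V H"
  shows "even (vdegree H v)"
  using assms vdegree_eq_0_iff[OF two_factor_on_finite[OF assms], of v] two_factor_on_Union[OF assms(2)]
  by (cases "v \<in> V") (auto simp: two_factor_on_iff)

lemma vdegree_two_factor_le:
  assumes "finite V" "two_factor_on V H"
  shows "vdegree H v \<le> 2"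
  using assms vdegree_eq_0_iff[OF two_factor_on_finite[OF assms], of v] two_factor_on_Union[OF assms(2)]
  by (cases "v \<in> V") (auto simp: two_factor_on_iff)

text \<open>The sum over all subsets is the expansion of the product of the factors
  \<open>1 + f x \<le> exp (f x)\<close>; the empty subset accounts for the subtracted 1.\<close>

lemma sum_prod_Pow_le_exp:
  fixes f :: "'a \<Rightarrow> real"
  assumes "finite A" "\<And>x. x \<in> A \<Longrightarrow> 0 \<le> f x"
  shows "(\<Sum>X\<in>Pow A - {{}}. \<Prod>x\<in>X. f x) \<le> exp (\<Sum>x\<in>A. f x) - 1"
proof -
  have "(\<Sum>X\<in>Pow A. \<Prod>x\<in>X. f x) = (\<Prod>x\<in>A. f x + 1)"
    using prod_add[OF assms(1), of f "\<lambda>_. 1"] by simp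
  also have "\<dots> \<le> (\<Prod>x\<in>A. exp (f x))"
    using assms(2) by (intro prod_mono) (auto simp: add.commute intro: exp_ge_add_one_self)
  also have "\<dots> = exp (\<Sum>x\<in>A. f x)" by (simp add: exp_sum assms(1))
  finally show ?thesis
    using assms(1) by (subst sum_diff) auto
qed

text \<open>A 2-factor \<open>H'\<close> is determined by the cycles into which the even graph \<open>H \<triangle> H'\<close> decomposes;
  writing \<open>p = y q\<close>, the weight of \<open>H'\<close> is the product of the weights of these cycles since
  \<open>H - H'\<close> and \<open>H' - H\<close> have the same size.\<close>

lemma sum_power_card_diff_le:
  fixes y q :: real
  assumes N: "finite N" and V: "V \<subseteq> N" "two_factor_on V H" and yq: "0 \<le> y" "0 \<le> q"
  defines "F \<equiv> {H'. H' \<noteq> H \<and> H' \<subseteq> complete_edges N \<and> card (\<Union>H') = card V \<and> two_factor_on (\<Union>H') H'}"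
  shows "(\<Sum>H'\<in>F. (y * q) ^ card (H' - H))
           \<le> exp (\<Sum>C | is_cycle C \<and> C \<subseteq> complete_edges N. \<Prod>e\<in>C. if e \<in> H then y else q) - 1"
proof -
  define w where "w e = (if e \<in> H then y else q)" for e
  define Cyc where "Cyc = {C. is_cycle C \<and> C \<subseteq> complete_edges N}"
  have finV: "finite V" using V N finite_subset by blast
  have finH: "finite H" using two_factor_on_finite[OF finV V(2)] .
  have HN: "H \<subseteq> complete_edges N"
    using two_factor_on_subset[OF finV V(2)] complete_edges_mono[OF V(1)] by blast
  have finCyc: "finite Cyc"
    unfolding Cyc_def by (rule finite_subset[of _ "Pow (complete_edges N)"]) (use N in auto)
  have finF: "finite F"
    unfolding F_def by (rule finite_subset[of _ "Pow (complete_edges N)"]) (use N in auto)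
  have "(\<Sum>H'\<in>F. (y * q) ^ card (H' - H)) \<le> (\<Sum>\<D>\<in>Pow Cyc - {{}}. \<Prod>C\<in>\<D>. prod w C)"
  proof (rule sum_le_included[where i = "\<lambda>\<D>. (H - \<Union>\<D>) \<union> (\<Union>\<D> - H)", OF finF])
    show "finite (Pow Cyc - {{}})" using finCyc by simp
    show "\<forall>\<D>\<in>Pow Cyc - {{}}. 0 \<le> (\<Prod>C\<in>\<D>. prod w C)"
      using yq by (intro ballI prod_nonneg) (auto simp: w_def)
    show "\<forall>H'\<in>F. \<exists>\<D>\<in>Pow Cyc - {{}}. (H - \<Union>\<D>) \<union> (\<Union>\<D> - H) = H' \<and>
            (y * q) ^ card (H' - H) \<le> (\<Prod>C\<in>\<D>. prod w C)"
    proof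
      fix H' assume "H' \<in> F"
      hence H': "H' \<noteq> H" "H' \<subseteq> complete_edges N" "card (\<Union>H') = card V" "two_factor_on (\<Union>H') H'"
        by (auto simp: F_def)
      have "\<Union>H' \<subseteq> N" using H'(2) unfolding complete_edges_def by blast
      hence finU: "finite (\<Union>H')" using N finite_subset by blast
      have finH': "finite H'" using two_factor_on_finite[OF finU H'(4)] .
      define D where "D = (H - H') \<union> (H' - H)"
      have "even (vdegree D v)" for v
      proof -
        \<comment> \<open>The degree in the symmetric difference is the sum of the degrees in
          \<open>H\<close> and \<open>H'\<close> minus twice the degree in their
          intersection.\<close>
        have "vdegree D v = vdegree (H - H \<inter> H') v + vdegree (H' - H \<inter> H') v"
          unfolding D_def using finH finH' by (subst vdegree_Un) (auto simp: Diff_Int)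
        also have "\<dots> = (vdegree H v - vdegree (H \<inter> H') v) + (vdegree H' v - vdegree (H \<inter> H') v)"
          using finH finH' by (simp add: vdegree_diff)
        finally show ?thesis
          using even_vdegree_two_factor[OF finV V(2), of v] even_vdegree_two_factor[OF finU H'(4), of v]
            vdegree_mono[OF finH, of "H \<inter> H'" v] vdegree_mono[OF finH', of "H \<inter> H'" v] by auto
      qed
      moreover have "D \<subseteq> complete_edges N" using HN H'(2) by (auto simp: D_def)
      moreover from this have "\<forall>e\<in>D. card e = 2" by (auto simp: complete_edges_def)
      moreover have finD: "finite D" using finH finH' by (simp add: D_def)
      ultimately obtain \<D> where \<D>: "finite \<D>" "\<forall>C\<in>\<D>. is_cycle C" "disjoint \<D>" "\<Union>\<D> = D"
        using even_graph_decomposition by meson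
      have "card (H \<inter> H') + card (H - H') = card H" "card (H \<inter> H') + card (H' - H) = card H'"
        using card_Int_Diff[OF finH, of H'] card_Int_Diff[OF finH', of H]
        by (simp_all add: Int_commute)
      \<comment> \<open>Both 2-factors have \<open>card V\<close> vertices and hence
        \<open>card V\<close> edges.\<close>
      hence same: "card (H - H') = card (H' - H)"
        using H'(3) card_two_factor[OF finV V(2)] card_two_factor[OF finU H'(4)] by simp
      have "(\<Prod>C\<in>\<D>. prod w C) = prod w D"
        unfolding \<D>(4)[symmetric] using \<D>(2,3) is_cycle_finite
        by (subst prod.Union_disjoint) (auto simp: comp_def dest: disjointD)
      also have "\<dots> = prod w (H - H') * prod w (H' - H)"
        unfolding D_def using finH finH' by (intro prod.union_disjoint) auto
      also have "\<dots> = (y * q) ^ card (H' - H)"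
        using same by (simp add: w_def power_mult_distrib)
      finally have "(\<Prod>C\<in>\<D>. prod w C) = (y * q) ^ card (H' - H)" .
      \<comment> \<open>The condition \<open>H' \<noteq> H\<close> excludes the empty family, which
        is the source of the \<open>- 1\<close> in the bound.\<close>
      moreover have "\<D> \<noteq> {}" using \<D>(4) H'(1) by (auto simp: D_def)
      moreover have "\<D> \<subseteq> Cyc"
        using \<D>(2,4) \<open>D \<subseteq> complete_edges N\<close> by (auto simp: Cyc_def)
      moreover have "(H - \<Union>\<D>) \<union> (\<Union>\<D> - H) = H'" unfolding \<D>(4) D_def by blast
      ultimately show "\<exists>\<D>\<in>Pow Cyc - {{}}. (H - \<Union>\<D>) \<union> (\<Union>\<D> - H) = H' \<and>
            (y * q) ^ card (H' - H) \<le> (\<Prod>C\<in>\<D>. prod w C)"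
        by (intro bexI[of _ \<D>]) auto
    qed
  qed
  also have "\<dots> \<le> exp (\<Sum>C\<in>Cyc. prod w C) - 1"
    using finCyc yq by (intro sum_prod_Pow_le_exp prod_nonneg) (auto simp: w_def)
  finally show ?thesis by (simp add: w_def Cyc_def)
qed

section \<open>The planted model for small edge density\<close>

lemma measure_bind_pmf_eq_expectation:
  "measure_pmf.prob (bind_pmf p f) A = measure_pmf.expectation p (\<lambda>x. measure_pmf.prob (f x) A)"
proof -
  have "ennreal (measure_pmf.prob (bind_pmf p f) A)
      = (\<integral>\<^sup>+x. ennreal (measure_pmf.prob (f x) A) \<partial>measure_pmf p)"
    by (simp add: measure_pmf.emeasure_eq_measure[symmetric])
  also have "\<dots> = ennreal (measure_pmf.expectation p (\<lambda>x. measure_pmf.prob (f x) A))"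
    by (intro nn_integral_eq_integral measure_pmf.integrable_const_bound[where B = 1]) auto
  finally show ?thesis by (simp add: integral_nonneg_AE)
qed

lemma integrable_prob: "integrable (measure_pmf p) (\<lambda>x. measure_pmf.prob (f x) A)"
  by (intro measure_pmf.integrable_const_bound[where B = 1]) auto

lemma prob_bind_pmf_le:
  assumes "\<And>x. x \<in> set_pmf p \<Longrightarrow> measure_pmf.prob (f x) A \<le> c"
  shows "measure_pmf.prob (bind_pmf p f) A \<le> c"
  unfolding measure_bind_pmf_eq_expectation
  using assms by (intro measure_pmf.integral_le_const integrable_prob) (auto simp: AE_measure_pmf_iff)

lemma prob_bind_pmf_ge:
  assumes "\<And>x. x \<in> set_pmf p \<Longrightarrow> c \<le> measure_pmf.prob (f x) A"
  shows "c \<le> measure_pmf.prob (bind_pmf p f) A"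
  unfolding measure_bind_pmf_eq_expectation
  using assms by (intro measure_pmf.integral_ge_const integrable_prob) (auto simp: AE_measure_pmf_iff)

lemma set_pmf_erdos_renyi: "G \<in> set_pmf (erdos_renyi n p) \<Longrightarrow> G \<subseteq> complete_edges {1..n}"
  by (auto simp: erdos_renyi_def)

lemma prob_erdos_renyi_superset:
  assumes "0 \<le> p" "p \<le> 1" "E \<subseteq> complete_edges {1..n}"
  shows "measure_pmf.prob (erdos_renyi n p) {G. E \<subseteq> G} = p ^ card E"
proof -
  let ?A = "complete_edges {1..n}"
  have "measure_pmf.prob (erdos_renyi n p) {G. E \<subseteq> G}
      = measure_pmf.prob (Pi_pmf ?A False (\<lambda>_. bernoulli_pmf p))
          (Pi ?A (\<lambda>e. if e \<in> E then {True} else UNIV))"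
    unfolding erdos_renyi_def measure_map_pmf
    by (rule arg_cong[where f = "measure_pmf.prob _"]) (use assms(3) in \<open>auto split: if_splits\<close>)
  also have "\<dots> = (\<Prod>e\<in>?A. if e \<in> E then p else 1)"
    using assms(1,2) by (subst measure_Pi_pmf_Pi) (auto intro!: prod.cong simp: measure_pmf_single)
  also have "\<dots> = p ^ card E"
    using assms(3) by (simp add: prod.inter_restrict[symmetric] Int_absorb1)
  finally show ?thesis .
qed

text \<open>Drawing \<open>G\<^sub>0\<close> last allows \<open>V\<close> and \<open>H\<close> to be
  fixed before the random edges are exposed.\<close>

lemma planted_cycles_eq:
  "planted_cycles n l \<delta> =
     bind_pmf (pmf_of_set {V. V \<subseteq> {1..n} \<and> card V = planted_size n \<delta>}) (\<lambda>V.
       bind_pmf (pmf_of_set {H. two_factor_on V H}) (\<lambda>H.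
         map_pmf (\<lambda>G\<^sub>0. (G\<^sub>0 \<union> H, H)) (erdos_renyi n (l / real n))))"
  unfolding planted_cycles_def map_pmf_def
  by (subst bind_commute_pmf) (subst bind_commute_pmf, rule refl)

lemma planted_size_le: "0 < \<delta> \<Longrightarrow> \<delta> \<le> 1 \<Longrightarrow> planted_size n \<delta> \<le> n"
proof -
  assume "0 < \<delta>" "\<delta> \<le> 1"
  hence "\<delta> * real n \<le> real n" by (simp add: mult_left_le_one_le)
  hence "\<lfloor>\<delta> * real n\<rfloor> \<le> int n" by (simp add: floor_le_iff)
  thus ?thesis by (simp add: planted_size_def)
qed

lemma exists_two_factor:
  assumes "finite V" "3 \<le> card V"
  shows "{H. two_factor_on V H} \<noteq> {}"
proof -
  obtain xs where xs: "set xs = V" "distinct xs" using finite_distinct_list[OF assms(1)] by blast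
  hence "3 \<le> length xs" using assms(2) by (simp add: distinct_card[symmetric])
  moreover from this have "\<Union>(cycle_edges xs) = V"
    using xs Union_cycle_edges[of xs] by force
  ultimately have "is_cycle (cycle_edges xs)" "\<Union>(cycle_edges xs) = V"
    using xs is_cycle_iff by blast+
  thus ?thesis using is_cycle_two_factor by force
qed

lemma set_pmf_vertex_sets:
  assumes "k \<le> n"
  shows "set_pmf (pmf_of_set {V. V \<subseteq> {1..n} \<and> card V = k}) = {V. V \<subseteq> {1..n} \<and> card V = k}"
proof (rule set_pmf_of_set)
  show "{V. V \<subseteq> {1..n} \<and> card V = k} \<noteq> {}"
    using obtain_subset_with_card_n[of k "{1..n}"] assms by force
qed simp

definition other_two_factor :: "nat \<Rightarrow> edges \<Rightarrow> edges \<Rightarrow> bool" where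
  "other_two_factor k G H \<longleftrightarrow> (\<exists>H'\<in>two_factors_in G k. H' \<noteq> H)"

text \<open>Only the average over \<open>H\<close> has to be bounded for each \<open>V\<close>: a
  single \<open>H\<close> may contain many short cycles, so the cycle count is controlled only on
  average.\<close>

lemma prob_planted_cycles_le:
  fixes c :: real
  assumes k: "planted_size n \<delta> = k" "3 \<le> k" "k \<le> n"
    and avg: "\<And>V. V \<subseteq> {1..n} \<Longrightarrow> card V = k \<Longrightarrow>
      (\<Sum>H | two_factor_on V H. measure_pmf.prob (erdos_renyi n (l / real n)) {G. (G \<union> H, H) \<in> A})
        \<le> c * real (card {H. two_factor_on V H})"
  shows "measure_pmf.prob (planted_cycles n l \<delta>) A \<le> c"
  unfolding planted_cycles_eq k(1)
proof (rule prob_bind_pmf_le, unfold set_pmf_vertex_sets[OF k(3)], clarify)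
  fix V assume V: "V \<subseteq> {1..n}" "k = card V"
  have "finite V" using V(1) finite_subset by blast
  hence fin: "finite {H. two_factor_on V H}" and ne: "{H. two_factor_on V H} \<noteq> {}"
    using finite_two_factors exists_two_factor V k by auto
  have "0 < card {H. two_factor_on V H}" using fin ne card_gt_0_iff by blast
  thus "measure_pmf.prob (pmf_of_set {H. two_factor_on V H} \<bind> (\<lambda>H.
      map_pmf (\<lambda>G\<^sub>0. (G\<^sub>0 \<union> H, H)) (erdos_renyi n (l / real n)))) A \<le> c"
    unfolding measure_bind_pmf_eq_expectation integral_pmf_of_set[OF ne fin]
    using avg[OF V(1) V(2)[symmetric]] by (simp add: divide_le_eq vimage_def)
qed

lemma prob_planted_cycles_ge:
  assumes k: "planted_size n \<delta> = k" "3 \<le> k" "k \<le> n"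
    and ge: "\<And>V H. V \<subseteq> {1..n} \<Longrightarrow> card V = k \<Longrightarrow> two_factor_on V H \<Longrightarrow>
      c \<le> measure_pmf.prob (erdos_renyi n (l / real n)) {G. (G \<union> H, H) \<in> A}"
  shows "c \<le> measure_pmf.prob (planted_cycles n l \<delta>) A"
  unfolding planted_cycles_eq k(1)
proof (intro prob_bind_pmf_ge, unfold set_pmf_vertex_sets[OF k(3)], clarify)
  fix V H assume V: "V \<subseteq> {1..n}" "k = card V" and H: "H \<in> set_pmf (pmf_of_set {H. two_factor_on V H})"
  have "finite V" using V(1) finite_subset by blast
  hence "two_factor_on V H" using H finite_two_factors exists_two_factor V k by simp
  thus "c \<le> measure_pmf.prob (map_pmf (\<lambda>G\<^sub>0. (G\<^sub>0 \<union> H, H)) (erdos_renyi n (l / real n))) A"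
    using ge V by (simp add: vimage_def)
qed

text \<open>The hidden \<open>H\<close> almost surely belongs to \<open>two_factors_in G k\<close>,
  so this set differs from \<open>{H}\<close> exactly when it has another element.\<close>

lemma prob_two_factor_unique:
  assumes k: "planted_size n \<delta> = k" "3 \<le> k" "k \<le> n"
  shows "1 - measure_pmf.prob (planted_cycles n l \<delta>) {(G, H). two_factors_in G k = {H}}
           = measure_pmf.prob (planted_cycles n l \<delta>) {(G, H). other_two_factor k G H}"
proof -
  have hidden: "H \<in> two_factors_in G k" if "(G, H) \<in> set_pmf (planted_cycles n l \<delta>)" for G H
  proof -
    from that obtain V where V: "V \<subseteq> {1..n}" "card V = k" "H \<subseteq> G"
        "H \<in> set_pmf (pmf_of_set {H. two_factor_on V H})"
      unfolding planted_cycles_eq k(1) set_bind_pmf set_map_pmf set_pmf_vertex_sets[OF k(3)] by blast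
    moreover have "finite V" using V finite_subset by blast
    ultimately have "two_factor_on V H" using finite_two_factors exists_two_factor k by simp
    thus ?thesis using V by (auto simp: two_factors_in_def dest: two_factor_on_Union)
  qed
  have "1 - measure_pmf.prob (planted_cycles n l \<delta>) {(G, H). two_factors_in G k = {H}}
      = measure_pmf.prob (planted_cycles n l \<delta>) (- {(G, H). two_factors_in G k = {H}})"
    using measure_pmf.prob_compl[of "{(G, H). two_factors_in G k = {H}}" "planted_cycles n l \<delta>"]
    by (simp add: Compl_eq_Diff_UNIV)
  also have "\<dots> = measure_pmf.prob (planted_cycles n l \<delta>) {(G, H). other_two_factor k G H}"
    by (rule measure_pmf.finite_measure_eq_AE)
      (auto simp: AE_measure_pmf_iff other_two_factor_def dest!: hidden)
  finally show ?thesis .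
qed

lemma exp_minus_one_le: "0 \<le> x \<Longrightarrow> x \<le> 1 \<Longrightarrow> exp x - 1 \<le> 2 * (x :: real)"
  using exp_bound[of x] mult_left_le[of x x] by (simp add: power2_eq_square)

text \<open>Union bound over \<open>H'\<close>, which lies in \<open>G \<union> H\<close> iff
  \<open>H' - H\<close> lies in \<open>G\<close>. The total cycle weight \<open>W\<close> is then
  split according to whether a cycle is contained in \<open>H\<close>.\<close>

lemma prob_other_two_factor_le:
  fixes y q :: real
  assumes yq: "0 \<le> y" "0 \<le> q" "y * q \<le> 1" and V: "V \<subseteq> {1..n}" "two_factor_on V H"
  shows "measure_pmf.prob (erdos_renyi n (y * q)) {G. other_two_factor (card V) (G \<union> H) H}
      \<le> 2 * (\<Sum>C | is_cycle C \<and> C \<subseteq> H. y ^ card C)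
         + 2 * (\<Sum>m=3..n. n * q * (2 * y + n * q) ^ (m - 1))"
proof -
  let ?N = "{1..n}"
  define w where "w e = (if e \<in> H then y else q)" for e
  define W where "W = (\<Sum>C | is_cycle C \<and> C \<subseteq> complete_edges ?N. prod w C)"
  define F where "F = {H'. H' \<noteq> H \<and> H' \<subseteq> complete_edges ?N \<and> card (\<Union>H') = card V \<and> two_factor_on (\<Union>H') H'}"
  define P where "P = measure_pmf.prob (erdos_renyi n (y * q)) {G. other_two_factor (card V) (G \<union> H) H}"
  have finV: "finite V" using V finite_subset by blast
  have finH: "finite H" using two_factor_on_finite[OF finV V(2)] .
  have HN: "H \<subseteq> complete_edges ?N"
    using two_factor_on_subset[OF finV V(2)] complete_edges_mono[OF V(1)] by blast
  have finF: "finite F"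
    unfolding F_def by (rule finite_subset[of _ "Pow (complete_edges ?N)"]) auto
  have "P \<le> measure_pmf.prob (erdos_renyi n (y * q)) (\<Union>H'\<in>F. {G. H' - H \<subseteq> G})"
    unfolding P_def
  proof (rule measure_pmf.finite_measure_mono_AE)
    show "AE G in measure_pmf (erdos_renyi n (y * q)).
        G \<in> {G. other_two_factor (card V) (G \<union> H) H} \<longrightarrow> G \<in> (\<Union>H'\<in>F. {G. H' - H \<subseteq> G})"
    proof (unfold AE_measure_pmf_iff, clarify)
      fix G assume "G \<in> set_pmf (erdos_renyi n (y * q))" "other_two_factor (card V) (G \<union> H) H"
      then obtain H' where "G \<subseteq> complete_edges ?N" "H' \<subseteq> G \<union> H" "H' \<noteq> H"
          "card (\<Union>H') = card V" "two_factor_on (\<Union>H') H'"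
        using set_pmf_erdos_renyi by (auto simp: other_two_factor_def two_factors_in_def)
      thus "G \<in> (\<Union>H'\<in>F. {G. H' - H \<subseteq> G})"
        using HN by (intro UN_I[of H']) (auto simp: F_def)
    qed
  qed auto
  also have "\<dots> \<le> (\<Sum>H'\<in>F. measure_pmf.prob (erdos_renyi n (y * q)) {G. H' - H \<subseteq> G})"
    by (rule measure_pmf.finite_measure_subadditive_finite[OF finF]) auto
  also have "\<dots> = (\<Sum>H'\<in>F. (y * q) ^ card (H' - H))"
    using yq by (intro sum.cong refl prob_erdos_renyi_superset) (auto simp: F_def)
  also have "\<dots> \<le> exp W - 1"
    unfolding F_def W_def w_def using sum_power_card_diff_le[OF _ V yq(1,2)] by simp
  finally have P: "P \<le> exp W - 1" .
  have "0 \<le> W" unfolding W_def w_def using yq by (intro sum_nonneg prod_nonneg) auto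
  \<comment> \<open>For \<open>W \<le> 1\<close> this linearizes the exponential; otherwise the
    right-hand side exceeds the trivial bound 1.\<close>
  have "P \<le> 2 * W"
  proof (cases "W \<le> 1")
    case True
    thus ?thesis using P exp_minus_one_le[OF \<open>0 \<le> W\<close>] by linarith
  next
    case False
    moreover have "P \<le> 1" unfolding P_def by simp
    ultimately show ?thesis by linarith
  qed
  also have "W = (\<Sum>C | is_cycle C \<and> C \<subseteq> H. prod w C)
      + (\<Sum>C | is_cycle C \<and> C \<subseteq> complete_edges ?N \<and> \<not> C \<subseteq> H. prod w C)"
  proof -
    have "finite {C. is_cycle C \<and> C \<subseteq> H}"
      by (rule finite_subset[of _ "Pow H"]) (use finH in auto)
    moreover have "finite {C. is_cycle C \<and> C \<subseteq> complete_edges ?N \<and> \<not> C \<subseteq> H}"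
      by (rule finite_subset[of _ "Pow (complete_edges ?N)"]) auto
    moreover have "{C. is_cycle C \<and> C \<subseteq> complete_edges ?N}
        = {C. is_cycle C \<and> C \<subseteq> H} \<union> {C. is_cycle C \<and> C \<subseteq> complete_edges ?N \<and> \<not> C \<subseteq> H}"
      using HN by blast
    ultimately show ?thesis unfolding W_def by (simp only:) (rule sum.union_disjoint, auto)
  qed
  also have "(\<Sum>C | is_cycle C \<and> C \<subseteq> H. prod w C) = (\<Sum>C | is_cycle C \<and> C \<subseteq> H. y ^ card C)"
  proof (intro sum.cong refl)
    fix C assume "C \<in> {C. is_cycle C \<and> C \<subseteq> H}"
    hence "prod w C = (\<Prod>e\<in>C. y)" by (intro prod.cong) (auto simp: w_def)
    thus "prod w C = y ^ card C" by simp
  qed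
  also have "2 * ((\<Sum>C | is_cycle C \<and> C \<subseteq> H. y ^ card C)
      + (\<Sum>C | is_cycle C \<and> C \<subseteq> complete_edges ?N \<and> \<not> C \<subseteq> H. prod w C))
    \<le> 2 * ((\<Sum>C | is_cycle C \<and> C \<subseteq> H. y ^ card C) + (\<Sum>m=3..n. n * q * (2 * y + n * q) ^ (m - 1)))"
    using sum_weight_cycles_not_subset[OF _ finH vdegree_two_factor_le[OF finV V(2)] yq(1,2), of ?N]
    by (simp add: w_def)
  finally show ?thesis by (simp add: P_def)
qed

lemma sum_half_powers: "(\<Sum>m\<le>n. (1 / 2) ^ m) = 2 - (1 / 2 :: real) ^ n"
  by (induction n) auto

lemma sum_le_half_powers:
  fixes f :: "nat \<Rightarrow> real"
  assumes "\<And>m. 3 \<le> m \<Longrightarrow> f m \<le> c * (1 / 2) ^ m" "0 \<le> c"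
  shows "(\<Sum>m=3..n. f m) \<le> 2 * c"
proof -
  have "(\<Sum>m=3..n. f m) \<le> (\<Sum>m=3..n. c * (1 / 2) ^ m)"
    using assms by (intro sum_mono) auto
  also have "\<dots> \<le> (\<Sum>m\<le>n. c * (1 / 2) ^ m)"
    using assms by (intro sum_mono2) auto
  also have "\<dots> = c * (2 - (1 / 2) ^ n)"
    by (simp only: sum_distrib_left[symmetric] sum_half_powers)
  also have "\<dots> \<le> c * 2" using assms by (intro mult_left_mono) auto
  finally show ?thesis by simp
qed

text \<open>Here \<open>y = s\<close> and \<open>q = s / n\<close> with \<open>s = sqrt l\<close>.
  The bound exceeds 1 if \<open>s > 1 / 6\<close>; otherwise \<open>3 * s \<le> 1 / 2\<close> makes
  all sums geometric. The constant 24 is 16 from the cycles inside \<open>H\<close> plus 8 from the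
  other cycles.\<close>

lemma prob_planted_other_two_factor_le:
  assumes k: "planted_size n \<delta> = k" "3 \<le> k" "k \<le> n" and l: "0 < l" "l / real n \<le> 1"
  shows "measure_pmf.prob (planted_cycles n l \<delta>) {(G, H). other_two_factor k G H} \<le> 24 * sqrt l"
proof (cases "sqrt l \<le> 1 / 6")
  case False
  have "measure_pmf.prob (planted_cycles n l \<delta>) {(G, H). other_two_factor k G H} \<le> 1" by simp
  thus ?thesis using False by linarith
next
  case True
  define s where "s = sqrt l"
  have s: "0 \<le> s" "s \<le> 1 / 6" "s * s = l" using True l by (auto simp: s_def)
  have n: "0 < n" using k by auto
  hence p: "s * (s / n) = l / n" using s by simp
  have pow: "x ^ m \<le> x * 2 * (1 / 2) ^ m" if x: "0 \<le> x" "x \<le> 1 / 2" and m: "3 \<le> m" for x :: real and m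
  proof -
    define i where "i = m - 1"
    have i: "m = Suc i" using m by (simp add: i_def)
    have "x ^ i \<le> (1 / 2) ^ i" using x by (intro power_mono) auto
    thus ?thesis using x by (simp add: i mult_left_mono)
  qed
  have R: "(\<Sum>m=3..n. n * (s / n) * (2 * s + n * (s / n)) ^ (m - 1)) \<le> 2 * (2 * s)"
  proof (rule sum_le_half_powers)
    fix m :: nat assume m: "3 \<le> m"
    have "(3 * s) ^ (m - 1) \<le> (1 / 2) ^ (m - 1)" using s by (intro power_mono) auto
    also have "\<dots> = 2 * (1 / 2) ^ m" using m by (cases m) auto
    finally have "s * (3 * s) ^ (m - 1) \<le> s * (2 * (1 / 2) ^ m)" using s by (intro mult_left_mono)
    thus "n * (s / n) * (2 * s + n * (s / n)) ^ (m - 1) \<le> 2 * s * (1 / 2) ^ m" using n by simp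
  qed (use s in auto)
  have L: "(\<Sum>j=3..k. real (1 + j) * s ^ j) \<le> 2 * (4 * s)"
  proof (rule sum_le_half_powers)
    fix j :: nat assume j: "3 \<le> j"
    \<comment> \<open>The polynomial factor is absorbed by replacing \<open>s\<close> by
      \<open>2 * s\<close>, which is still at most \<open>1 / 2\<close>.\<close>
    have "1 + j \<le> 2 ^ j" by (induction j) auto
    hence "real (1 + j) \<le> 2 ^ j" by (metis of_nat_le_iff of_nat_numeral of_nat_power)
    hence "real (1 + j) * s ^ j \<le> 2 ^ j * s ^ j" using s by (intro mult_right_mono) auto
    also have "\<dots> = (2 * s) ^ j" by (simp add: power_mult_distrib)
    also have "\<dots> \<le> 4 * s * (1 / 2) ^ j" using pow[of "2 * s" j] s j by simp
    finally show "real (1 + j) * s ^ j \<le> 4 * s * (1 / 2) ^ j" .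
  qed (use s in auto)
  show ?thesis
  proof (rule prob_planted_cycles_le[OF k])
    fix V assume V: "V \<subseteq> {1..n}" "card V = k"
    define T where "T = card {H. two_factor_on V H}"
    have finV: "finite V" using V finite_subset by blast
    have "(\<Sum>H | two_factor_on V H. measure_pmf.prob (erdos_renyi n (l / n))
            {G. other_two_factor k (G \<union> H) H})
        \<le> (\<Sum>H | two_factor_on V H. 2 * (\<Sum>C | is_cycle C \<and> C \<subseteq> H. s ^ card C) + 2 * (2 * (2 * s)))"
    proof (rule sum_mono)
      fix H assume "H \<in> {H. two_factor_on V H}"
      hence "two_factor_on V H" by simp
      from prob_other_two_factor_le[of s "s / n" V n H, OF _ _ _ V(1) this]
      show "measure_pmf.prob (erdos_renyi n (l / n)) {G. other_two_factor k (G \<union> H) H}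
          \<le> 2 * (\<Sum>C | is_cycle C \<and> C \<subseteq> H. s ^ card C) + 2 * (2 * (2 * s))"
        using R s l p V(2) by simp
    qed
    also have "\<dots> = 2 * (\<Sum>H | two_factor_on V H. \<Sum>C | is_cycle C \<and> C \<subseteq> H. s ^ card C) + 8 * s * T"
      by (simp add: sum.distrib sum_distrib_left T_def)
    also have "\<dots> \<le> 2 * (2 * (4 * s) * T) + 8 * s * T"
      using sum_weight_cycles_in_two_factors[OF finV s(1)] mult_right_mono[OF L, of "real T"] V(2)
      by (simp add: T_def)
    finally show "(\<Sum>H | two_factor_on V H. measure_pmf.prob (erdos_renyi n (l / n))
            {G. (G \<union> H, H) \<in> {(G, H). other_two_factor k G H}}) \<le> 24 * sqrt l * real (card {H. two_factor_on V H})"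
      by (simp add: T_def s_def)
  qed
qed

section \<open>Independent switches\<close>

lemma prob_pair_pmf_Times:
  "measure_pmf.prob (pair_pmf M N) (A \<times> B) = measure_pmf.prob M A * measure_pmf.prob N B"
proof -
  \<comment> \<open>Intersecting with the supports makes both sets countable, as
    \<open>measure_pmf_prob_product\<close> requires.\<close>
  have "measure_pmf.prob (pair_pmf M N) (A \<times> B)
      = measure_pmf.prob (pair_pmf M N) ((A \<inter> set_pmf M) \<times> (B \<inter> set_pmf N))"
    by (subst measure_Int_set_pmf[symmetric]) (simp add: Times_Int_Times)
  also have "\<dots> = measure_pmf.prob M A * measure_pmf.prob N B"
    by (subst measure_pmf_prob_product) (auto simp: measure_Int_set_pmf)
  finally show ?thesis .
qed

lemma prob_Pi_bernoulli_all:
  assumes "0 \<le> p" "p \<le> 1" "finite E"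
  shows "measure_pmf.prob (Pi_pmf E False (\<lambda>_. bernoulli_pmf p)) {f. \<forall>e\<in>E. f e} = p ^ card E"
proof -
  have "{f. \<forall>e\<in>E. f e} = Pi E (\<lambda>_. {True})" by auto
  thus ?thesis using assms by (simp add: measure_Pi_pmf_Pi measure_pmf_single)
qed

text \<open>Induction over the blocks: \<open>A\<close> splits into \<open>E i\<close> and a rest
  \<open>B\<close> that contains all other blocks, and the coordinates on the two parts are
  independent.\<close>

lemma prob_Pi_bernoulli_no_block:
  assumes p: "0 \<le> p" "p \<le> 1" and fin: "finite I" "finite A"
    and E: "\<And>i. i \<in> I \<Longrightarrow> E i \<subseteq> A" "disjoint_family_on E I"
  shows "measure_pmf.prob (Pi_pmf A False (\<lambda>_. bernoulli_pmf p)) {f. \<forall>i\<in>I. \<not> (\<forall>e\<in>E i. f e)}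
           = (\<Prod>i\<in>I. 1 - p ^ card (E i))"
  using fin E
proof (induction I arbitrary: A rule: finite_induct)
  case (insert i I)
  define B where "B = A - E i"
  have A: "A = E i \<union> B" "E i \<inter> B = {}" "finite (E i)" "finite B"
    using insert.prems(1) insert.prems(2)[of i] finite_subset[of "E i" A] by (auto simp: B_def)
  have EB: "E j \<subseteq> B" if "j \<in> I" for j
  proof -
    have "i \<noteq> j" using insert.hyps(2) that by blast
    hence "E i \<inter> E j = {}" using disjoint_family_onD[OF insert.prems(3), of i j] that by simp
    moreover have "E j \<subseteq> A" using insert.prems(2) that by simp
    ultimately show ?thesis unfolding B_def by blast
  qed
  let ?ber = "\<lambda>_. bernoulli_pmf p" and ?g = "\<lambda>(f, h) e. if e \<in> E i then f e else h e"
  have "?g -` {f. \<forall>j\<in>insert i I. \<not> (\<forall>e\<in>E j. f e)}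
      = (- {f. \<forall>e\<in>E i. f e}) \<times> {h. \<forall>j\<in>I. \<not> (\<forall>e\<in>E j. h e)}" (is "?L = ?R")
  proof -
    have "e \<notin> E i" if "j \<in> I" "e \<in> E j" for j e using EB[OF that(1)] that A(2) by blast
    hence eq: "(\<forall>e\<in>E j. ?g (f, h) e) = (\<forall>e\<in>E j. h e)" if "j \<in> I" for j f h
      using that by auto
    have eqI: "(\<forall>j\<in>I. \<not> (\<forall>e\<in>E j. ?g (f, h) e)) = (\<forall>j\<in>I. \<not> (\<forall>e\<in>E j. h e))" for f h
      by (rule ball_cong[OF refl], rule arg_cong[where f = Not], rule eq)
    have eqi: "(\<forall>e\<in>E i. ?g (f, h) e) = (\<forall>e\<in>E i. f e)" for f h by auto
    have L: "(f, h) \<in> ?L \<longleftrightarrow>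
        \<not> (\<forall>e\<in>E i. ?g (f, h) e) \<and> (\<forall>j\<in>I. \<not> (\<forall>e\<in>E j. ?g (f, h) e))" for f h
      by simp
    have R: "(f, h) \<in> ?R \<longleftrightarrow> \<not> (\<forall>e\<in>E i. f e) \<and> (\<forall>j\<in>I. \<not> (\<forall>e\<in>E j. h e))" for f h
      by simp
    have "(f, h) \<in> ?L \<longleftrightarrow> (f, h) \<in> ?R" for f h unfolding L R eqi eqI ..
    thus ?thesis by (simp only: set_eq_iff split_paired_All simp_thms)
  qed
  hence "measure_pmf.prob (Pi_pmf A False ?ber) {f. \<forall>j\<in>insert i I. \<not> (\<forall>e\<in>E j. f e)}
      = measure_pmf.prob (Pi_pmf (E i) False ?ber) (- {f. \<forall>e\<in>E i. f e})
        * measure_pmf.prob (Pi_pmf B False ?ber) {h. \<forall>j\<in>I. \<not> (\<forall>e\<in>E j. h e)}"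
    unfolding A(1) Pi_pmf_union[OF A(3,4,2)] measure_map_pmf by (simp add: prob_pair_pmf_Times)
  also have "measure_pmf.prob (Pi_pmf (E i) False ?ber) (- {f. \<forall>e\<in>E i. f e}) = 1 - p ^ card (E i)"
    using prob_Pi_bernoulli_all[OF p A(3)]
      measure_pmf.prob_compl[of "{f. \<forall>e\<in>E i. f e}" "Pi_pmf (E i) False ?ber"]
    by (simp add: Compl_eq_Diff_UNIV)
  also have "measure_pmf.prob (Pi_pmf B False ?ber) {h. \<forall>j\<in>I. \<not> (\<forall>e\<in>E j. h e)}
      = (\<Prod>j\<in>I. 1 - p ^ card (E j))"
    using insert.prems(3) EB A(4)
    by (intro insert.IH) (auto simp: disjoint_family_on_def)
  finally show ?case using insert.hyps by simp
qed simp

lemma prob_erdos_renyi_no_block: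
  assumes p: "0 \<le> p" "p \<le> 1" and fin: "finite I"
    and E: "\<And>i. i \<in> I \<Longrightarrow> E i \<subseteq> complete_edges {1..n}" "disjoint_family_on E I"
  shows "measure_pmf.prob (erdos_renyi n p) {G. \<forall>i\<in>I. \<not> E i \<subseteq> G} = (\<Prod>i\<in>I. 1 - p ^ card (E i))"
proof -
  have "(E i \<subseteq> {e \<in> complete_edges {1..n}. f e}) = (\<forall>e\<in>E i. f e)" if "i \<in> I" for i f
    using E(1)[OF that] by auto
  hence "(\<lambda>f. {e \<in> complete_edges {1..n}. f e}) -` {G. \<forall>i\<in>I. \<not> E i \<subseteq> G}
      = {f. \<forall>i\<in>I. \<not> (\<forall>e\<in>E i. f e)}"
    by (simp add: set_eq_iff)
  thus ?thesis
    unfolding erdos_renyi_def measure_map_pmf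
    using prob_Pi_bernoulli_no_block[OF p fin _ E] by simp
qed

section \<open>Switches between the edges of an induced matching\<close>

lemma two_factor_on_switch:
  assumes V: "finite V" "two_factor_on V H"
    and old: "{a, b} \<in> H" "{c, d} \<in> H" and new: "{a, c} \<notin> H" "{b, d} \<notin> H"
    and dist: "distinct [a, b, c, d]"
  shows "two_factor_on V (insert {a, c} (insert {b, d} (H - {{a, b}, {c, d}})))"
proof -
  have H: "H \<subseteq> complete_edges V" "\<forall>v\<in>V. vdegree H v = 2" "finite H"
    using V two_factor_on_iff two_factor_on_finite by auto
  have ne: "{a, b} \<noteq> {c, d}" "{a, c} \<noteq> {b, d}" using dist by (auto simp: doubleton_eq_iff)
  have old_deg: "vdegree {{a, b}, {c, d}} v = (if v \<in> {c, d} then 1 else 0) + (if v \<in> {a, b} then 1 else 0)" for v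
    using ne vdegree_insert[of "{{c, d}}" "{a, b}" v] vdegree_insert[of "{}" "{c, d}" v] by auto
  have "vdegree (insert {a, c} (insert {b, d} (H - {{a, b}, {c, d}}))) v = vdegree H v" for v
  proof -
    have deg_new: "vdegree (insert {a, c} (insert {b, d} (H - {{a, b}, {c, d}}))) v
        = vdegree (H - {{a, b}, {c, d}}) v + (if v \<in> {b, d} then 1 else 0) + (if v \<in> {a, c} then 1 else 0)"
      using H(3) new ne by (simp add: vdegree_insert)
    have deg_diff: "vdegree (H - {{a, b}, {c, d}}) v = vdegree H v - vdegree {{a, b}, {c, d}} v"
      using H(3) old by (intro vdegree_diff) auto
    \<comment> \<open>The removed pair and the added pair both cover each of \<open>a\<close>,
      \<open>b\<close>, \<open>c\<close>, \<open>d\<close> exactly once.\<close>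
    have deg: "vdegree {{a, b}, {c, d}} v = (if v \<in> {b, d} then 1 else 0) + (if v \<in> {a, c} then 1 else 0)"
      unfolding old_deg using dist by simp
    have "vdegree {{a, b}, {c, d}} v \<le> vdegree H v"
      using old by (intro vdegree_mono H(3)) auto
    thus ?thesis unfolding deg_new deg_diff deg by linarith
  qed
  moreover have "a \<in> V" "b \<in> V" "c \<in> V" "d \<in> V" using old H(1) by (auto simp: complete_edges_def)
  ultimately show ?thesis
    using H dist V(1) by (auto simp: two_factor_on_iff complete_edges_iff)
qed

lemma card_edges_touching_le:
  assumes "finite H" "\<And>v. vdegree H v \<le> 2" "card f = 2"
  shows "card {e \<in> H. e \<inter> f \<noteq> {}} \<le> 4"
proof -
  obtain u v where f: "f = {u, v}" using assms(3) by (auto simp: card_2_iff)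
  have "card {e \<in> H. e \<inter> f \<noteq> {}} \<le> card ({e \<in> H. u \<in> e} \<union> {e \<in> H. v \<in> e})"
    using assms(1) by (intro card_mono) (auto simp: f)
  also have "\<dots> \<le> vdegree H u + vdegree H v" unfolding vdegree_def by (rule card_Un_le)
  finally show ?thesis using assms(2)[of u] assms(2)[of v] by linarith
qed

text \<open>For 2-factors \<open>H\<close>, the choice \<open>f = m\<close> makes distinct edges of
  \<open>M\<close> disjoint; the other \<open>f\<close> say that no edge of \<open>H\<close> joins
  two edges of \<open>M\<close>.\<close>

definition induced_matching :: "edges \<Rightarrow> edges \<Rightarrow> bool" where
  "induced_matching H M \<longleftrightarrow> M \<subseteq> H \<and>
     (\<forall>m\<in>M. \<forall>m'\<in>M. \<forall>f\<in>H. f \<inter> m \<noteq> {} \<and> f \<inter> m' \<noteq> {} \<longrightarrow> m = m')"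

text \<open>For a maximal induced matching \<open>M\<close>, every edge of \<open>H\<close> touches an edge that touches an edge of
  \<open>M\<close>, and an edge touches at most 4 edges.\<close>

lemma exists_large_induced_matching:
  assumes V: "finite V" "two_factor_on V H"
  shows "\<exists>M. induced_matching H M \<and> card V \<le> 16 * card M"
proof -
  have finH: "finite H" using two_factor_on_finite[OF V] .
  have card2: "card e = 2" if "e \<in> H" for e
    using two_factor_on_subset[OF V] that by (auto simp: complete_edges_def)
  define N where "N e = {e' \<in> H. e' \<inter> e \<noteq> {}}" for e
  have N: "finite (N e)" "card e = 2 \<Longrightarrow> card (N e) \<le> 4" for e
    using card_edges_touching_le[OF finH vdegree_two_factor_le[OF V]] finH by (auto simp: N_def)
  have "finite {M. induced_matching H M}"
    by (rule finite_subset[of _ "Pow H"]) (use finH in \<open>auto simp: induced_matching_def\<close>)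
  moreover have "induced_matching H {}" by (simp add: induced_matching_def)
  ultimately have "\<exists>M\<in>{M. induced_matching H M}. \<forall>M'\<in>{M. induced_matching H M}. M \<subseteq> M' \<longrightarrow> M = M'"
    by (intro finite_has_maximal) auto
  then obtain M where M: "induced_matching H M"
    and max: "\<And>M'. induced_matching H M' \<Longrightarrow> M \<subseteq> M' \<Longrightarrow> M = M'" by auto
  have MH: "M \<subseteq> H" using M by (simp add: induced_matching_def)
  hence finM: "finite M" using finH finite_subset by blast
  have "H \<subseteq> (\<Union>m\<in>M. \<Union>f\<in>N m. N f)"
  proof
    fix e assume e: "e \<in> H"
    hence "e \<noteq> {}" using card2 by force
    show "e \<in> (\<Union>m\<in>M. \<Union>f\<in>N m. N f)"
    proof (rule ccontr)
      assume not: "e \<notin> (\<Union>m\<in>M. \<Union>f\<in>N m. N f)"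
      hence no: "\<not> (f \<inter> m \<noteq> {} \<and> f \<inter> e \<noteq> {})" if "m \<in> M" "f \<in> H" for f m
        using e that unfolding N_def by blast
      hence "e \<notin> M" using e \<open>e \<noteq> {}\<close> by blast
      moreover have "induced_matching H (insert e M)"
        using M e no unfolding induced_matching_def by blast
      ultimately show False using max[of "insert e M"] by blast
    qed
  qed
  hence "card H \<le> card (\<Union>m\<in>M. \<Union>f\<in>N m. N f)" using finM N(1) by (intro card_mono) auto
  also have "\<dots> \<le> (\<Sum>m\<in>M. card (\<Union>f\<in>N m. N f))" by (rule card_UN_le[OF finM])
  also have "\<dots> \<le> (\<Sum>m\<in>M. 16)"
  proof (rule sum_mono)
    fix m assume "m \<in> M"
    hence m: "card (N m) \<le> 4" using N(2) card2 MH by blast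
    have "card (\<Union>f\<in>N m. N f) \<le> (\<Sum>f\<in>N m. card (N f))" by (rule card_UN_le[OF N(1)])
    also have "\<dots> \<le> (\<Sum>f\<in>N m. 4)"
      by (intro sum_mono N(2) card2) (simp add: N_def)
    finally show "card (\<Union>f\<in>N m. N f) \<le> 16" using m by simp
  qed
  finally show ?thesis using M card_two_factor[OF V] by auto
qed

text \<open>The blocks of two new edges belonging to different switches are disjoint, so the switches
  are available in \<open>G\<close> independently of each other.\<close>

lemma prob_other_two_factor_ge:
  assumes p: "0 \<le> p" "p \<le> 1" and V: "V \<subseteq> {1..n}" "two_factor_on V H" and h: "32 * h \<le> card V"
  shows "1 - (1 - p ^ 2) ^ (h ^ 2)
           \<le> measure_pmf.prob (erdos_renyi n p) {G. other_two_factor (card V) (G \<union> H) H}"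
proof -
  have finV: "finite V" using V finite_subset by blast
  have H: "H \<subseteq> complete_edges V" using two_factor_on_subset[OF finV V(2)] .
  obtain M where M: "induced_matching H M" and "card V \<le> 16 * card M"
    using exists_large_induced_matching[OF finV V(2)] by blast
  \<comment> \<open>From \<open>32 * h \<le> card V \<le> 16 * card M\<close>, so \<open>M\<close>
    has room for two disjoint subsets of size \<open>h\<close>.\<close>
  hence "2 * h \<le> card M" using h by linarith
  then obtain M' where M': "M' \<subseteq> M" "card M' = 2 * h" "finite M'"
    using obtain_subset_with_card_n by metis
  have "h \<le> card M'" using M' by simp
  then obtain M1 where M1: "M1 \<subseteq> M'" "card M1 = h" "finite M1"
    using obtain_subset_with_card_n by metis
  define M2 where "M2 = M' - M1"
  have M2: "card M2 = h" "finite M2" "M1 \<inter> M2 = {}"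
    using M1 M' by (auto simp: M2_def card_Diff_subset)
  have MH: "M1 \<subseteq> M" "M2 \<subseteq> M" "M \<subseteq> H"
    using M1 M' M by (auto simp: M2_def induced_matching_def)
  have "\<forall>m\<in>M. \<exists>a b. m = {a, b} \<and> a \<noteq> b"
    using MH(3) H complete_edges_iff by blast
  then obtain a b where ab: "\<And>m. m \<in> M \<Longrightarrow> m = {a m, b m} \<and> a m \<noteq> b m" by metis
  have matching: "m = m'" if "m \<in> M" "m' \<in> M" "f \<in> H" "f \<inter> m \<noteq> {}" "f \<inter> m' \<noteq> {}" for m m' f
    using M that unfolding induced_matching_def by blast
  have mem: "a m \<in> m" "b m \<in> m" if "m \<in> M" for m
    using ab[OF that] by blast+
  have meet: "m = m'" if "m \<in> M" "m' \<in> M" "m \<inter> m' \<noteq> {}" for m m'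
    using matching[OF that(1,2), of m] that MH(3) by blast
  have inj: "a m \<noteq> a m'" "a m \<noteq> b m'" "b m \<noteq> a m'" "b m \<noteq> b m'"
    if "m \<in> M" "m' \<in> M" "m \<noteq> m'" for m m'
  proof -
    have "m \<inter> m' = {}" using meet[OF that(1,2)] that(3) by blast
    thus "a m \<noteq> a m'" "a m \<noteq> b m'" "b m \<noteq> a m'" "b m \<noteq> b m'"
      using mem[OF that(1)] mem[OF that(2)] by auto
  qed
  \<comment> \<open>Taking the two edges from disjoint halves avoids having both
    \<open>(m, m')\<close> and \<open>(m', m)\<close>, whose blocks coincide.\<close>
  define I where "I = M1 \<times> M2"
  define E where "E = (\<lambda>(m, m'). {{a m, a m'}, {b m, b m'}})"
  have I: "m \<in> M \<and> m' \<in> M \<and> m \<noteq> m'" if "(m, m') \<in> I" for m m'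
    using that MH M2(3) by (auto simp: I_def)
  have finI: "finite I" "card I = h ^ 2"
    using M1 M2 by (auto simp: I_def card_cartesian_product power2_eq_square)
  have mV: "m \<subseteq> V" if "m \<in> M" for m
    using MH(3) H that by (auto simp: complete_edges_def)
  have EK: "E i \<subseteq> complete_edges {1..n}" if "i \<in> I" for i
  proof -
    obtain m m' where i: "i = (m, m')" by (cases i)
    hence m: "m \<in> M" "m' \<in> M" "m \<noteq> m'" using I that by auto
    have "{a m, b m, a m', b m'} \<subseteq> {1..n}"
      using mem[OF m(1)] mem[OF m(2)] mV[OF m(1)] mV[OF m(2)] V(1) by blast
    thus ?thesis using inj[OF m] by (auto simp: E_def i complete_edges_def)
  qed
  have disj: "disjoint_family_on E I"
    unfolding disjoint_family_on_def
  proof (intro ballI impI, rule ccontr)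
    fix i j assume ij: "i \<in> I" "j \<in> I" "i \<noteq> j" "E i \<inter> E j \<noteq> {}"
    obtain m m' l l' where eq: "i = (m, m')" "j = (l, l')" by (cases i, cases j)
    have M1M2: "m \<in> M1" "m' \<in> M2" "l \<in> M1" "l' \<in> M2" using ij eq by (auto simp: I_def)
    hence inM: "m \<in> M" "m' \<in> M" "l \<in> M" "l' \<in> M" "m \<noteq> l'" "m' \<noteq> l"
      using MH M2(3) by auto
    obtain e where "e \<in> E i" "e \<in> E j" using ij(4) by blast
    hence e: "e \<in> {{a m, a m'}, {b m, b m'}}" "e \<in> {{a l, a l'}, {b l, b l'}}"
      unfolding E_def eq by simp_all
    \<comment> \<open>A new edge has one end in each of the two matching edges it comes from, so it
      determines them; disjointness of \<open>M1\<close> and \<open>M2\<close> fixes which is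
      which.\<close>
    have "e \<inter> m \<noteq> {}" "e \<inter> m' \<noteq> {}"
      using e(1) mem[OF inM(1)] mem[OF inM(2)] by auto
    moreover have "e \<subseteq> l \<union> l'"
      using e(2) mem[OF inM(3)] mem[OF inM(4)] by auto
    ultimately have "m \<inter> l \<noteq> {} \<or> m \<inter> l' \<noteq> {}" "m' \<inter> l \<noteq> {} \<or> m' \<inter> l' \<noteq> {}" by blast+
    hence "m = l \<and> m' = l'" using meet inM by metis
    thus False using ij(3) eq by simp
  qed
  have card: "card (E i) = 2" if "i \<in> I" for i
  proof -
    obtain m m' where i: "i = (m, m')" by (cases i)
    hence m: "m \<in> M" "m' \<in> M" "m \<noteq> m'" using I that by auto
    have "{a m, a m'} \<noteq> {b m, b m'}"
      using ab[OF m(1)] inj[OF m] by (auto simp: doubleton_eq_iff)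
    thus ?thesis by (simp add: E_def i)
  qed
  have other: "other_two_factor (card V) (G \<union> H) H" if "i \<in> I" "E i \<subseteq> G" for i G
  proof -
    obtain m m' where i: "i = (m, m')" by (cases i)
    hence m: "m \<in> M" "m' \<in> M" "m \<noteq> m'" using I that by auto
    \<comment> \<open>An edge of \<open>H\<close> between \<open>m\<close> and \<open>m'\<close>
      would contradict that the matching is induced.\<close>
    have new: "{a m, a m'} \<notin> H" "{b m, b m'} \<notin> H"
      using matching[OF m(1,2)] mem[OF m(1)] mem[OF m(2)] m(3) by blast+
    define H' where "H' = insert {a m, a m'} (insert {b m, b m'} (H - {{a m, b m}, {a m', b m'}}))"
    have "distinct [a m, b m, a m', b m']"
      using inj[OF m] ab[OF m(1)] ab[OF m(2)] by auto
    moreover have "{a m, b m} \<in> H" "{a m', b m'} \<in> H" using ab m(1,2) MH(3) by auto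
    ultimately have "two_factor_on V H'"
      unfolding H'_def using new two_factor_on_switch[OF finV V(2)] by blast
    moreover from this have "\<Union>H' = V" by (rule two_factor_on_Union)
    moreover have "H' \<subseteq> G \<union> H" using that(2) by (auto simp: H'_def E_def i)
    moreover have "H' \<noteq> H" using new(1) by (auto simp: H'_def)
    ultimately show ?thesis
      unfolding other_two_factor_def two_factors_in_def by (intro bexI[of _ H']) auto
  qed
  have "1 - (1 - p ^ 2) ^ (h ^ 2) = 1 - (\<Prod>i\<in>I. 1 - p ^ card (E i))"
    using card finI by simp
  also have "\<dots> = 1 - measure_pmf.prob (erdos_renyi n p) {G. \<forall>i\<in>I. \<not> E i \<subseteq> G}"
    using prob_erdos_renyi_no_block[OF p finI(1) EK disj] by simp
  also have "\<dots> = measure_pmf.prob (erdos_renyi n p) (- {G. \<forall>i\<in>I. \<not> E i \<subseteq> G})"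
    using measure_pmf.prob_compl[of "{G. \<forall>i\<in>I. \<not> E i \<subseteq> G}" "erdos_renyi n p"]
    by (simp add: Compl_eq_Diff_UNIV)
  also have "\<dots> \<le> measure_pmf.prob (erdos_renyi n p) {G. other_two_factor (card V) (G \<union> H) H}"
    using other by (intro measure_pmf.finite_measure_mono) auto
  finally show ?thesis .
qed

section \<open>Asymptotics and the two regimes\<close>

lemma planted_size_ge: "\<delta> * real n - 1 \<le> real (planted_size n \<delta>)"
proof -
  have "\<delta> * real n - 1 \<le> of_int \<lfloor>\<delta> * real n\<rfloor>" by linarith
  also have "\<dots> \<le> real (planted_size n \<delta>)" by (simp add: planted_size_def)
  finally show ?thesis .
qed

lemma eventually_real_ge: "\<forall>\<^sub>F n in sequentially. c \<le> real n"
  using filterlim_real_sequentially by (simp add: filterlim_at_top)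

lemma eventually_planted_size_ge:
  assumes "0 < \<delta>"
  shows "\<forall>\<^sub>F n in sequentially. m \<le> planted_size n \<delta>"
proof -
  have "\<forall>\<^sub>F n in sequentially. (real m + 1) / \<delta> \<le> real n"
    by (rule eventually_real_ge)
  thus ?thesis
  proof eventually_elim
    case (elim n)
    hence "real m + 1 \<le> \<delta> * real n" using assms by (simp add: divide_le_eq mult.commute)
    thus ?case using planted_size_ge[of \<delta> n] by simp
  qed
qed

text \<open>With \<open>h\<close> of order \<open>n\<close>, the expected number
  \<open>p ^ 2 * h ^ 2\<close> of available switches is at least a positive constant when
  \<open>c > 0\<close>; then \<open>1 - p ^ 2 \<le> exp (- (p ^ 2))\<close> bounds the probability
  that none is available.\<close>

lemma prob_planted_other_two_factor_ge:
  assumes k: "planted_size n \<delta> = k" "3 \<le> k" "k \<le> n" and l: "0 < l" "l / real n \<le> 1"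
    and c: "0 \<le> c" "c \<le> l" and \<delta>: "0 < \<delta>" and n: "128 \<le> \<delta> * real n"
  shows "1 - exp (- ((c * \<delta> / 64) ^ 2))
           \<le> measure_pmf.prob (planted_cycles n l \<delta>) {(G, H). other_two_factor k G H}"
proof (rule prob_planted_cycles_ge[OF k])
  fix V H assume V: "V \<subseteq> {1..n}" "card V = k" "two_factor_on V H"
  define p where "p = l / real n"
  define h where "h = k div 32"
  have "0 < n" using k by simp
  have p: "0 \<le> p" "p \<le> 1" "c / n \<le> p" using l c by (auto simp: p_def divide_right_mono)
  have "k < 32 * (h + 1)" unfolding h_def by presburger
  hence "real k < 32 * (real h + 1)" by simp
  \<comment> \<open>Both roundings together cost less than half of \<open>\<delta> * n / 32\<close>,
    because \<open>\<delta> * n\<close> is at least 128.\<close>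
  hence h: "\<delta> * real n / 64 \<le> real h" using planted_size_ge[of \<delta> n] k(1) n by simp
  have "c * \<delta> / 64 = (c / n) * (\<delta> * n / 64)" using \<open>0 < n\<close> by simp
  also have "\<dots> \<le> p * real h" using p h c \<delta> by (intro mult_mono) auto
  finally have "(c * \<delta> / 64) ^ 2 \<le> (p * real h) ^ 2" using c \<delta> by (intro power_mono) auto
  hence "- real (h ^ 2) * p ^ 2 \<le> - ((c * \<delta> / 64) ^ 2)" by (simp add: power_mult_distrib mult.commute)
  have "(1 - p ^ 2) ^ (h ^ 2) \<le> exp (- (p ^ 2)) ^ (h ^ 2)"
    using p exp_ge_add_one_self[of "- (p ^ 2)"] by (intro power_mono) (auto simp: power_le_one)
  also have "\<dots> = exp (- real (h ^ 2) * p ^ 2)" by (simp add: exp_of_nat_mult[symmetric])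
  also have "\<dots> \<le> exp (- ((c * \<delta> / 64) ^ 2))"
    using \<open>- real (h ^ 2) * p ^ 2 \<le> _\<close> by simp
  finally have "1 - exp (- ((c * \<delta> / 64) ^ 2)) \<le> 1 - (1 - p ^ 2) ^ (h ^ 2)" by simp
  also have "\<dots> \<le> measure_pmf.prob (erdos_renyi n p) {G. other_two_factor k (G \<union> H) H}"
    using prob_other_two_factor_ge[OF p(1,2) V(1,3), of h] V(2) by (simp add: h_def)
  finally show "1 - exp (- ((c * \<delta> / 64) ^ 2))
      \<le> measure_pmf.prob (erdos_renyi n (l / n)) {G. (G \<union> H, H) \<in> {(G, H). other_two_factor k G H}}"
    by (simp add: p_def)
qed

theorem theorem5:
  fixes \<delta> :: real and l :: "nat \<Rightarrow> real"
  assumes "0 < \<delta>" and "\<delta> \<le> 1"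
    and "\<And>n. 0 < l n"
    and "\<forall>\<^sub>F n in sequentially. l n / real n \<le> 1"
  shows
    "(l \<in> o(\<lambda>_. 1) \<longrightarrow>
        (\<lambda>n. 1 - measure_pmf.prob (planted_cycles n (l n) \<delta>)
               {(G, H). two_factors_in G (planted_size n \<delta>) = {H}}) \<in> o(\<lambda>_. 1)) \<and>
     (l \<in> \<Omega>(\<lambda>_. 1) \<longrightarrow>
        (\<lambda>n. measure_pmf.prob (planted_cycles n (l n) \<delta>)
               {(G, H). \<exists>H'\<in>two_factors_in G (planted_size n \<delta>). H' \<noteq> H}) \<in> \<Omega>(\<lambda>_. 1))"
proof (intro conjI impI)
  have le: "planted_size n \<delta> \<le> n" for n using planted_size_le assms(1,2) .
  assume "l \<in> o(\<lambda>_. 1)"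
  hence "l \<longlonglongrightarrow> 0" using smalloD_tendsto by force
  hence "(\<lambda>n. 24 * sqrt (l n)) \<longlonglongrightarrow> 24 * sqrt 0" by (intro tendsto_intros)
  hence lim: "(\<lambda>n. 24 * sqrt (l n)) \<longlonglongrightarrow> 0" by simp
  let ?f = "\<lambda>n. 1 - measure_pmf.prob (planted_cycles n (l n) \<delta>)
               {(G, H). two_factors_in G (planted_size n \<delta>) = {H}}"
  \<comment> \<open>From size 3 on a 2-factor on \<open>V\<close> exists, so that
    \<open>pmf_of_set\<close> is applied to nonempty sets only.\<close>
  have "\<forall>\<^sub>F n in sequentially. ?f n \<le> 24 * sqrt (l n)"
    using eventually_planted_size_ge[OF assms(1), of 3] assms(4)
  proof eventually_elim
    case (elim n)
    show ?case
      using prob_two_factor_unique[OF refl elim(1) le]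
        prob_planted_other_two_factor_le[OF refl elim(1) le assms(3) elim(2)] by simp
  qed
  hence "?f \<longlonglongrightarrow> 0"
    by (intro tendsto_sandwich[OF _ _ tendsto_const lim]) auto
  thus "?f \<in> o(\<lambda>_. 1)" by (intro smalloI_tendsto) auto
next
  have le: "planted_size n \<delta> \<le> n" for n using planted_size_le assms(1,2) .
  assume "l \<in> \<Omega>(\<lambda>_. 1)"
  then obtain c where c: "0 < c" "\<forall>\<^sub>F n in sequentially. norm (l n) \<ge> c * norm (1 :: real)"
    by (rule landau_omega.bigE)
  define b where "b = 1 - exp (- ((c * \<delta> / 64) ^ 2))"
  have "0 < b" using c(1) assms(1) by (simp add: b_def)
  have "\<forall>\<^sub>F n in sequentially. 128 / \<delta> \<le> real n" by (rule eventually_real_ge)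
  hence "\<forall>\<^sub>F n in sequentially. b \<le> measure_pmf.prob (planted_cycles n (l n) \<delta>)
               {(G, H). \<exists>H'\<in>two_factors_in G (planted_size n \<delta>). H' \<noteq> H}"
    using eventually_planted_size_ge[OF assms(1), of 3] assms(4) c(2)
  proof eventually_elim
    case (elim n)
    have "c \<le> l n" using elim(4) assms(3)[of n] by simp
    moreover have "128 \<le> \<delta> * real n" using elim(1) assms(1) by (simp add: divide_le_eq mult.commute)
    ultimately show ?case
      using prob_planted_other_two_factor_ge[OF refl elim(2) le assms(3) elim(3), of c] c(1) assms(1)
      by (simp add: b_def other_two_factor_def)
  qed
  thus "(\<lambda>n. measure_pmf.prob (planted_cycles n (l n) \<delta>)
               {(G, H). \<exists>H'\<in>two_factors_in G (planted_size n \<delta>). H' \<noteq> H}) \<in> \<Omega>(\<lambda>_. 1)"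
    using \<open>0 < b\<close> by (intro landau_omega.bigI[of b]) (auto elim: eventually_mono)
qed

end
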